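(* Let $(X,\mathcal{V})$ be a semi-coarse space and let $\mathfrak{R}(X,\mathcal{V})=\bigcup_{V\in\mathcal{V}}V\subset X\times X$ be its roof. Then $H(X,\mathcal{V})\cong H(X,\mathfrak{R}(X,\mathcal{V}))$.
   Context: A semi-coarse structure on a set $X$ is a collection $\mathcal{V}$ of subsets of $X\times X$ (controlled sets) containing the diagonal $\Delta_X$ and closed under subsets, finite unions and inverses $V\mapsto V^{-1}=\{(y,x):(x,y)\in V\}$; $(X,\mathcal V)$ is a semi-coarse space. The roof need not itself belong to $\mathcal{V}$. For a subset $E\subset X\times X$, let $\Sigma_E$ be the simplicial complex whose $0$-simplices are all $\{x\}$, $x\in X$, and whose $n$-simplices ($n\ge1$) are the sets $\{x_0,\dots,x_n\}$ of $n+1$ distinct points with $(x_i,x_j)\in E$ for all $i,j\in\{0,\dots,n\}$. Let $C_*(X,E)$ be the simplicial chain complex of $\Sigma_E$ with $\mathbb{Z}$ coefficients: $C_q(X,E)$ is generated by symbols $[v_0,\dots,v_q]$ with $\{v_0,\dots,v_q\}$ a simplex of $\Sigma_E$, with $[v_0,\dots,v_q]=0$ if the vertices are not pairwise distinct and $[v_{\sigma(0)},\dots,v_{\sigma(q)}]=\operatorname{sgn}(\sigma)[v_0,\dots,v_q]$, and $\partial_q[v_0,\dots,v_q]=\sum_{i=0}^q(-1)^i[v_0,\dots,\hat v_i,\dots,v_q]$. $H(X,E)=H_*(X,E)$ is its (graded) homology. For $E\subset E'$ the inclusion of complexes induces $\pi_E^{E'}:H(X,E)\to H(X,E')$, and the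 semi-coarse homology is $H(X,\mathcal{V})=\varinjlim\{H(X,E),\pi_E^{E'},\mathcal{V}\}$, where $\mathcal{V}$ is directed by inclusion. *)

theory Defs
  imports "HOL-Algebra.Free_Abelian_Groups" "HOL-Combinatorics.Permutations"
begin

section \<open>Semi-coarse spaces\<close>

locale semi_coarse_space =
  fixes X :: "'a set" and \<V> :: "('a \<times> 'a) set set"
  assumes controlled_subset: "V \<in> \<V> \<Longrightarrow> V \<subseteq> X \<times> X"
    and diagonal_controlled: "Id_on X \<in> \<V>"
    and controlled_mono: "V \<in> \<V> \<Longrightarrow> W \<subseteq> V \<Longrightarrow> W \<in> \<V>"
    and controlled_Un: "V \<in> \<V> \<Longrightarrow> W \<in> \<V> \<Longrightarrow> V \<union> W \<in> \<V>"
    and controlled_converse: "V \<in> \<V> \<Longrightarrow> V\<inverse> \<in> \<V>"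

definition roof :: "('a \<times> 'a) set set \<Rightarrow> ('a \<times> 'a) set"
  where "roof \<V> = \<Union>\<V>"

section \<open>Maps induced on quotient groups\<close>

text \<open>The homomorphism \<open>G Mod N \<rightarrow> G' Mod N'\<close> induced by a homomorphism \<open>f\<close> from
  \<open>G\<close> to \<open>G'\<close> with \<open>f ` N \<subseteq> N'\<close>; the set below is then a singleton for every coset \<open>A\<close>.\<close>

definition quotient_map ::
    "('h, 'm) monoid_scheme \<Rightarrow> 'h set \<Rightarrow> ('g \<Rightarrow> 'h) \<Rightarrow> 'g set \<Rightarrow> 'h set"
  where "quotient_map G' N' f A = the_elem ((\<lambda>a. N' #>\<^bsub>G'\<^esub> f a) ` A)"

lemma quotient_map_r_coset:
  assumes G: "group G" and G': "group G'" and f: "f \<in> hom G G'"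
    and N: "subgroup N G" and N': "subgroup N' G'" and sub: "f ` N \<subseteq> N'"
    and a: "a \<in> carrier G"
  shows "quotient_map G' N' f (N #>\<^bsub>G\<^esub> a) = N' #>\<^bsub>G'\<^esub> f a"
proof -
  interpret G: group G by fact
  interpret G': group G' by fact
  have "N' #>\<^bsub>G'\<^esub> f (n \<otimes>\<^bsub>G\<^esub> a) = N' #>\<^bsub>G'\<^esub> f a" if n: "n \<in> N" for n
  proof -
    have nG: "n \<in> carrier G" using N n by (meson subgroup.mem_carrier)
    have fn: "f n \<in> N'" using sub n by blast
    have fa: "f a \<in> carrier G'" using f a by (auto simp: hom_def)
    have "f (n \<otimes>\<^bsub>G\<^esub> a) = f n \<otimes>\<^bsub>G'\<^esub> f a" using f a nG by (simp add: hom_def)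
    then have "f (n \<otimes>\<^bsub>G\<^esub> a) \<in> N' #>\<^bsub>G'\<^esub> f a" using fn by (auto simp: r_coset_def)
    then show ?thesis using G'.repr_independence[OF _ fa N'] by metis
  qed
  moreover have "N #>\<^bsub>G\<^esub> a = (\<lambda>n. n \<otimes>\<^bsub>G\<^esub> a) ` N" by (auto simp: r_coset_def)
  moreover have "N \<noteq> {}" using N by (auto dest: subgroup.one_closed)
  ultimately have "(\<lambda>b. N' #>\<^bsub>G'\<^esub> f b) ` (N #>\<^bsub>G\<^esub> a) = {N' #>\<^bsub>G'\<^esub> f a}"
    by (simp add: image_image image_constant_conv)
  then show ?thesis by (simp add: quotient_map_def)
qed

section \<open>Oriented simplicial homology\<close>

text \<open>A simplicial complex is given by its set \<open>K\<close> of nonempty simplices.\<close>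

definition vertex_lists :: "'a set set \<Rightarrow> nat \<Rightarrow> 'a list set"
  where "vertex_lists K q = {vs. length vs = Suc q \<and> set vs \<in> K}"

abbreviation list_chain_group :: "'a set set \<Rightarrow> nat \<Rightarrow> ('a list \<Rightarrow>\<^sub>0 int) monoid"
  where "list_chain_group K q \<equiv> free_Abelian_group (vertex_lists K q)"

text \<open>Since \<open>permute_list \<sigma> [v\<^sub>0, \<dots>, v\<^sub>q]\<close> is \<open>[v\<^bsub>\<sigma> 0\<^esub>, \<dots>, v\<^bsub>\<sigma> q\<^esub>]\<close>, the following subgroup is
  generated by the two defining relations of oriented simplices.\<close>

definition orientation_relations :: "'a set set \<Rightarrow> nat \<Rightarrow> ('a list \<Rightarrow>\<^sub>0 int) set"
  where "orientation_relations K q = generate (list_chain_group K q)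
    ({frag_of vs | vs. vs \<in> vertex_lists K q \<and> \<not> distinct vs} \<union>
     {frag_of (permute_list \<sigma> vs) - frag_cmul (sign \<sigma>) (frag_of vs) | \<sigma> vs.
        vs \<in> vertex_lists K q \<and> \<sigma> permutes {..q}})"

definition chain_group :: "'a set set \<Rightarrow> nat \<Rightarrow> ('a list \<Rightarrow>\<^sub>0 int) set monoid"
  where "chain_group K q = list_chain_group K q Mod orientation_relations K q"

definition list_boundary :: "nat \<Rightarrow> 'a list \<Rightarrow> ('a list \<Rightarrow>\<^sub>0 int)"
  where "list_boundary q vs =
    (\<Sum>i\<le>q. frag_cmul ((-1) ^ i) (frag_of (take i vs @ drop (Suc i) vs)))"

text \<open>The boundary from degree \<open>q\<close> to degree \<open>q - 1\<close>; it is only used for \<open>q > 0\<close>.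
  In degree \<open>0\<close> every chain is a cycle (the complex is not augmented).\<close>

definition boundary :: "'a set set \<Rightarrow> nat \<Rightarrow> ('a list \<Rightarrow>\<^sub>0 int) set \<Rightarrow> ('a list \<Rightarrow>\<^sub>0 int) set"
  where "boundary K q = quotient_map (list_chain_group K (q - 1))
    (orientation_relations K (q - 1)) (frag_extend (list_boundary q))"

definition cycles :: "'a set set \<Rightarrow> nat \<Rightarrow> ('a list \<Rightarrow>\<^sub>0 int) set set"
  where "cycles K q =
    (if q = 0 then carrier (chain_group K 0)
     else kernel (chain_group K q) (chain_group K (q - 1)) (boundary K q))"

definition boundaries :: "'a set set \<Rightarrow> nat \<Rightarrow> ('a list \<Rightarrow>\<^sub>0 int) set set"
  where "boundaries K q = boundary K (Suc q) ` carrier (chain_group K (Suc q))"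

definition cycle_group :: "'a set set \<Rightarrow> nat \<Rightarrow> ('a list \<Rightarrow>\<^sub>0 int) set monoid"
  where "cycle_group K q = (chain_group K q)\<lparr>carrier := cycles K q\<rparr>"

definition simplicial_homology ::
    "'a set set \<Rightarrow> nat \<Rightarrow> ('a list \<Rightarrow>\<^sub>0 int) set set monoid"
  where "simplicial_homology K q = cycle_group K q Mod boundaries K q"

text \<open>The chain map and the map in homology induced by an inclusion into a complex \<open>K'\<close>.\<close>

definition inclusion_chain_map ::
    "'a set set \<Rightarrow> nat \<Rightarrow> ('a list \<Rightarrow>\<^sub>0 int) set \<Rightarrow> ('a list \<Rightarrow>\<^sub>0 int) set"
  where "inclusion_chain_map K' q =
    quotient_map (list_chain_group K' q) (orientation_relations K' q) (\<lambda>c. c)"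

definition inclusion_homology_map ::
    "'a set set \<Rightarrow> nat \<Rightarrow> ('a list \<Rightarrow>\<^sub>0 int) set set \<Rightarrow> ('a list \<Rightarrow>\<^sub>0 int) set set"
  where "inclusion_homology_map K' q =
    quotient_map (cycle_group K' q) (boundaries K' q) (inclusion_chain_map K' q)"

section \<open>Direct limits of groups\<close>

text \<open>The direct limit of groups \<open>G i\<close> (\<open>i \<in> I\<close>) and homomorphisms \<open>f i j\<close> from \<open>G i\<close> to
  \<open>G j\<close> (\<open>i \<le> j\<close>), indexed by a nonempty directed set, is the disjoint union of the groups
  modulo eventual equality; two classes are multiplied at a common upper index.\<close>

definition direct_limit_rel ::
    "'i set \<Rightarrow> ('i \<Rightarrow> 'i \<Rightarrow> bool) \<Rightarrow> ('i \<Rightarrow> 'g monoid) \<Rightarrow> ('i \<Rightarrow> 'i \<Rightarrow> 'g \<Rightarrow> 'g) \<Rightarrow>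
      (('i \<times> 'g) \<times> ('i \<times> 'g)) set"
  where "direct_limit_rel I leq G f =
    {((i, a), (j, b)) | i a j b. i \<in> I \<and> a \<in> carrier (G i) \<and> j \<in> I \<and> b \<in> carrier (G j) \<and>
       (\<exists>k\<in>I. leq i k \<and> leq j k \<and> f i k a = f j k b)}"

definition direct_limit ::
    "'i set \<Rightarrow> ('i \<Rightarrow> 'i \<Rightarrow> bool) \<Rightarrow> ('i \<Rightarrow> 'g monoid) \<Rightarrow> ('i \<Rightarrow> 'i \<Rightarrow> 'g \<Rightarrow> 'g) \<Rightarrow>
      ('i \<times> 'g) set monoid"
  where "direct_limit I leq G f =
    \<lparr>carrier = (SIGMA i:I. carrier (G i)) // direct_limit_rel I leq G f,
     monoid.mult = (\<lambda>A B. the_elem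
       {direct_limit_rel I leq G f `` {(k, f i k a \<otimes>\<^bsub>G k\<^esub> f j k b)} | i a j b k.
          (i, a) \<in> A \<and> (j, b) \<in> B \<and> k \<in> I \<and> leq i k \<and> leq j k}),
     one = the_elem {direct_limit_rel I leq G f `` {(i, \<one>\<^bsub>G i\<^esub>)} | i. i \<in> I}\<rparr>"

locale directed_system =
  fixes I :: "'i set" and leq :: "'i \<Rightarrow> 'i \<Rightarrow> bool"
    and G :: "'i \<Rightarrow> 'g monoid" and f :: "'i \<Rightarrow> 'i \<Rightarrow> 'g \<Rightarrow> 'g"
  assumes nonempty: "I \<noteq> {}"
    and le_refl: "i \<in> I \<Longrightarrow> leq i i"
    and le_trans: "i \<in> I \<Longrightarrow> j \<in> I \<Longrightarrow> k \<in> I \<Longrightarrow> leq i j \<Longrightarrow> leq j k \<Longrightarrow> leq i k"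
    and directed: "i \<in> I \<Longrightarrow> j \<in> I \<Longrightarrow> \<exists>k\<in>I. leq i k \<and> leq j k"
    and groups: "i \<in> I \<Longrightarrow> group (G i)"
    and homs: "i \<in> I \<Longrightarrow> j \<in> I \<Longrightarrow> leq i j \<Longrightarrow> f i j \<in> hom (G i) (G j)"
    and map_id: "i \<in> I \<Longrightarrow> a \<in> carrier (G i) \<Longrightarrow> f i i a = a"
    and map_comp: "i \<in> I \<Longrightarrow> j \<in> I \<Longrightarrow> k \<in> I \<Longrightarrow> leq i j \<Longrightarrow> leq j k \<Longrightarrow> a \<in> carrier (G i) \<Longrightarrow>
      f j k (f i j a) = f i k a"
begin

abbreviation "R \<equiv> direct_limit_rel I leq G f"

lemma map_closed: "i \<in> I \<Longrightarrow> j \<in> I \<Longrightarrow> leq i j \<Longrightarrow> a \<in> carrier (G i) \<Longrightarrow> f i j a \<in> carrier (G j)"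
  using homs by (auto simp: hom_def)

lemma relI:
  "i \<in> I \<Longrightarrow> a \<in> carrier (G i) \<Longrightarrow> j \<in> I \<Longrightarrow> b \<in> carrier (G j) \<Longrightarrow> k \<in> I \<Longrightarrow>
   leq i k \<Longrightarrow> leq j k \<Longrightarrow> f i k a = f j k b \<Longrightarrow> ((i, a), (j, b)) \<in> R"
  unfolding direct_limit_rel_def by blast

lemma relE:
  assumes "((i, a), (j, b)) \<in> R"
  obtains k where "i \<in> I" "a \<in> carrier (G i)" "j \<in> I" "b \<in> carrier (G j)" "k \<in> I"
    "leq i k" "leq j k" "f i k a = f j k b"
  using assms unfolding direct_limit_rel_def by blast

lemma equiv_rel: "equiv (SIGMA i:I. carrier (G i)) R"
proof (rule equivI)
  show "R \<subseteq> (SIGMA i:I. carrier (G i)) \<times> (SIGMA i:I. carrier (G i))"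
    unfolding direct_limit_rel_def by blast
  show "refl_on (SIGMA i:I. carrier (G i)) R"
    unfolding refl_on_def by (auto intro: relI le_refl)
  show "sym R"
    unfolding sym_def by (auto elim!: relE intro: relI)
  show "trans R"
  proof (rule transI, clarify)
    fix i a j b k c
    assume "((i, a), (j, b)) \<in> R" "((j, b), (k, c)) \<in> R"
    then obtain m n where i: "i \<in> I" "a \<in> carrier (G i)" and j: "j \<in> I" "b \<in> carrier (G j)"
      and k: "k \<in> I" "c \<in> carrier (G k)"
      and m: "m \<in> I" "leq i m" "leq j m" "f i m a = f j m b"
      and n: "n \<in> I" "leq j n" "leq k n" "f j n b = f k n c"
      by (elim relE) blast
    obtain p where p: "p \<in> I" "leq m p" "leq n p" using directed m(1) n(1) by blast
    have "f i p a = f k p c"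
      using map_comp i j k m n p by metis
    then show "((i, a), (k, c)) \<in> R"
      using i k m n p by (meson relI le_trans)
  qed
qed

lemma class_map:
  assumes "i \<in> I" "a \<in> carrier (G i)" "k \<in> I" "leq i k"
  shows "R `` {(i, a)} = R `` {(k, f i k a)}"
proof -
  have "((i, a), (k, f i k a)) \<in> R"
    using assms by (intro relI[where k = k]) (auto simp: map_closed le_refl map_id)
  then show ?thesis using equiv_class_eq[OF equiv_rel] by blast
qed

lemma class_mult:
  assumes i: "i \<in> I" "a \<in> carrier (G i)" and j: "j \<in> I" "b \<in> carrier (G j)"
    and k: "k \<in> I" "leq i k" "leq j k"
  shows "R `` {(i, a)} \<otimes>\<^bsub>direct_limit I leq G f\<^esub> R `` {(j, b)} =
    R `` {(k, f i k a \<otimes>\<^bsub>G k\<^esub> f j k b)}"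
proof -
  have main: "R `` {(m, f i' m a' \<otimes>\<^bsub>G m\<^esub> f j' m b')} = R `` {(k, f i k a \<otimes>\<^bsub>G k\<^esub> f j k b)}"
    if A: "((i, a), (i', a')) \<in> R" and B: "((j, b), (j', b')) \<in> R"
      and m: "m \<in> I" "leq i' m" "leq j' m" for i' a' j' b' m
  proof -
    from A obtain p where i': "i' \<in> I" "a' \<in> carrier (G i')"
      and p: "p \<in> I" "leq i p" "leq i' p" "f i p a = f i' p a'" by (elim relE)
    from B obtain r where j': "j' \<in> I" "b' \<in> carrier (G j')"
      and r: "r \<in> I" "leq j r" "leq j' r" "f j r b = f j' r b'" by (elim relE)
    obtain s where s: "s \<in> I" "leq p s" "leq r s" using directed p r by blast
    obtain t where t: "t \<in> I" "leq k t" "leq m t" using directed k m by blast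
    obtain u where u: "u \<in> I" "leq s u" "leq t u" using directed s t by blast
    have pu: "leq p u" "leq r u" "leq k u" "leq m u"
      using le_trans p(1) r(1) k(1) m(1) s t u by blast+
    have a: "f i u a = f i' u a'" using map_comp i i' p u pu by metis
    have b: "f j u b = f j' u b'" using map_comp j j' r u pu by metis
    have c1: "f i k a \<in> carrier (G k)" "f j k b \<in> carrier (G k)"
      using i j k map_closed by auto
    have c2: "f i' m a' \<in> carrier (G m)" "f j' m b' \<in> carrier (G m)"
      using i' j' m map_closed by auto
    have "f k u (f i k a \<otimes>\<^bsub>G k\<^esub> f j k b) = f i u a \<otimes>\<^bsub>G u\<^esub> f j u b"
      using homs[OF k(1) u(1) pu(3)] c1 i j k u pu by (simp add: hom_mult map_comp)
    moreover have "f m u (f i' m a' \<otimes>\<^bsub>G m\<^esub> f j' m b') = f i' u a' \<otimes>\<^bsub>G u\<^esub> f j' u b'"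
      using homs[OF m(1) u(1) pu(4)] c2 i' j' m u pu by (simp add: hom_mult map_comp)
    moreover have "f i k a \<otimes>\<^bsub>G k\<^esub> f j k b \<in> carrier (G k)"
        "f i' m a' \<otimes>\<^bsub>G m\<^esub> f j' m b' \<in> carrier (G m)"
      using c1 c2 groups k m by (simp_all add: group.is_monoid monoid.m_closed)
    ultimately show ?thesis
      using class_map[OF k(1) _ u(1) pu(3)] class_map[OF m(1) _ u(1) pu(4)] a b by simp
  qed
  have refl: "((i, a), (i, a)) \<in> R" "((j, b), (j, b)) \<in> R"
    using relI[OF i i i(1) le_refl le_refl refl] relI[OF j j j(1) le_refl le_refl refl] i j by auto
  have "{R `` {(m, f i' m a' \<otimes>\<^bsub>G m\<^esub> f j' m b')} | i' a' j' b' m.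
      (i', a') \<in> R `` {(i, a)} \<and> (j', b') \<in> R `` {(j, b)} \<and> m \<in> I \<and> leq i' m \<and> leq j' m}
    = {R `` {(k, f i k a \<otimes>\<^bsub>G k\<^esub> f j k b)}}" (is "?L = {?x}")
  proof
    show "?L \<subseteq> {?x}" using main by blast
    have "?x \<in> ?L" using refl k by blast
    then show "{?x} \<subseteq> ?L" by blast
  qed
  then show ?thesis by (simp add: direct_limit_def)
qed

lemma class_one:
  assumes i: "i \<in> I"
  shows "\<one>\<^bsub>direct_limit I leq G f\<^esub> = R `` {(i, \<one>\<^bsub>G i\<^esub>)}"
proof -
  have "R `` {(j, \<one>\<^bsub>G j\<^esub>)} = R `` {(i, \<one>\<^bsub>G i\<^esub>)}" if j: "j \<in> I" for j
  proof -
    obtain k where k: "k \<in> I" "leq i k" "leq j k" using directed i j by blast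
    have "f i k \<one>\<^bsub>G i\<^esub> = \<one>\<^bsub>G k\<^esub>" "f j k \<one>\<^bsub>G j\<^esub> = \<one>\<^bsub>G k\<^esub>"
      using hom_one[OF homs] groups i j k by blast+
    moreover have "\<one>\<^bsub>G i\<^esub> \<in> carrier (G i)" "\<one>\<^bsub>G j\<^esub> \<in> carrier (G j)"
      using groups i j by (simp_all add: group.is_monoid)
    ultimately show ?thesis using class_map i j k by metis
  qed
  then have "{R `` {(j, \<one>\<^bsub>G j\<^esub>)} | j. j \<in> I} = {R `` {(i, \<one>\<^bsub>G i\<^esub>)}}" using i by blast
  then show ?thesis by (simp add: direct_limit_def)
qed

end

section \<open>Semi-coarse homology\<close>

text \<open>The complex \<open>\<Sigma>\<^sub>E\<close>. In positive dimension the condition on \<open>E\<close> includes the pairs \<open>(x, x)\<close>.\<close>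

definition relation_complex :: "'a set \<Rightarrow> ('a \<times> 'a) set \<Rightarrow> 'a set set"
  where "relation_complex X E = {{x} | x. x \<in> X} \<union>
    {S. finite S \<and> 2 \<le> card S \<and> S \<subseteq> X \<and> (\<forall>x\<in>S. \<forall>y\<in>S. (x, y) \<in> E)}"

definition relation_homology ::
    "'a set \<Rightarrow> ('a \<times> 'a) set \<Rightarrow> nat \<Rightarrow> ('a list \<Rightarrow>\<^sub>0 int) set set monoid"
  where "relation_homology X E q = simplicial_homology (relation_complex X E) q"

definition semi_coarse_homology ::
    "'a set \<Rightarrow> ('a \<times> 'a) set set \<Rightarrow> nat \<Rightarrow>
      (('a \<times> 'a) set \<times> ('a list \<Rightarrow>\<^sub>0 int) set set) set monoid"
  where "semi_coarse_homology X \<V> q =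
    direct_limit \<V> (\<subseteq>) (\<lambda>E. relation_homology X E q)
      (\<lambda>E E'. inclusion_homology_map (relation_complex X E') q)"

end

theory Submission
  imports Defs
begin

text \<open>A finite subset of the roof is controlled, because it lies in a finite union of controlled
  sets. Hence every simplex of the complex of the roof already lies in the complex of some controlled
  set, so the former complex is the directed union of the latter ones. Homology commutes with
  directed unions of complexes: a chain, an orientation relation or a bounding chain involves only
  finitely many simplices, so a cycle of the union is a cycle at some stage, and a cycle that bounds
  in the union bounds at some later stage.\<close>

section \<open>The boundary of an oriented simplex\<close>

text \<open>Chain groups are quotients by generated subgroups, and the maps between them are read
  off from cosets with \<open>the_elem\<close>, so nothing can be computed before these subgroups
  are known to be respected. For inclusions this is a matter of comparing generators. For the
  boundary it is the one real computation, since the boundary must be compatible with an arbitrary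
  permutation of the vertices; it is reduced to adjacent swaps, which a Leibniz rule for
  concatenated lists settles. Inclusions of chain groups are never compared by injectivity. It is
  only shown that a chain which becomes zero in the union becomes zero at a later stage. This weaker
  fact, used once to make lifted chains into cycles and once for bounding chains, is all that a
  direct limit asks for.\<close>

text \<open>Recursion on the list yields \<open>\<partial>\<partial> = 0\<close> without the double sum over pairs of faces. A singleton
  list has the face \<open>[]\<close>, as in the augmented complex; \<open>alternating_faces_append\<close> relies on this.\<close>

primrec alternating_faces :: "'a list \<Rightarrow> ('a list \<Rightarrow>\<^sub>0 int)" where
  "alternating_faces [] = 0"
| "alternating_faces (x # xs) = frag_of xs - frag_extend (\<lambda>ys. frag_of (x # ys)) (alternating_faces xs)"

text \<open>Deleting the head leaves \<open>xs\<close>. Deleting a later vertex keeps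
  \<open>x\<close> in front and lowers the index by one inside \<open>xs\<close>, which accounts for
  the minus sign in the recursion.\<close>

lemma list_boundary_eq_alternating_faces:
  "length vs = Suc q \<Longrightarrow> list_boundary q vs = alternating_faces vs"
proof (induction vs arbitrary: q)
  case (Cons x xs)
  show ?case
  proof (cases q)
    case 0
    then show ?thesis using Cons.prems by (simp add: list_boundary_def)
  next
    case (Suc p)
    then have "alternating_faces xs = list_boundary p xs" using Cons by simp
    then show ?thesis
      by (simp add: Suc list_boundary_def sum.atMost_Suc_shift frag_extend_sum frag_extend_cmul
          sum_negf[symmetric] del: sum.atMost_Suc)
  qed
qed simp

text \<open>The boundary formula for a cone with apex \<open>x\<close>: the base minus the cone over
  the boundary of the base. It has no exception for the list \<open>[]\<close>, because a one-vertex
  list has \<open>[]\<close> as its face.\<close>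

lemma frag_extend_alternating_faces_Cons:
  "frag_extend (\<lambda>ys. alternating_faces (x # ys)) c =
    c - frag_extend (\<lambda>ys. frag_of (x # ys)) (frag_extend alternating_faces c)"
proof -
  have "Poly_Mapping.keys c \<subseteq> UNIV" by simp
  then show ?thesis
    by (induction c rule: frag_induction) (auto simp: frag_extend_diff)
qed

text \<open>With the cone formula, the boundary of \<open>xs\<close> cancels against the base term
  of the cone over that boundary; what is left is a cone over the double boundary of
  \<open>xs\<close>, zero by induction.\<close>

lemma alternating_faces_twice: "frag_extend alternating_faces (alternating_faces vs) = 0"
proof (induction vs)
  case (Cons x xs)
  have "frag_extend alternating_faces (frag_extend (\<lambda>ys. frag_of (x # ys)) (alternating_faces xs))
      = frag_extend (\<lambda>ys. alternating_faces (x # ys)) (alternating_faces xs)"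
    by (subst frag_extend_compose[symmetric, unfolded o_def]) (auto simp: o_def intro!: frag_extend_eq)
  then show ?case
    by (simp add: frag_extend_diff frag_extend_alternating_faces_Cons Cons.IH del: alternating_faces.simps(2))
     (simp add: frag_extend_diff frag_extend_alternating_faces_Cons Cons.IH)
qed simp

lemma keys_alternating_faces:
  "ws \<in> Poly_Mapping.keys (alternating_faces vs) \<Longrightarrow> Suc (length ws) = length vs \<and> set ws \<subseteq> set vs"
proof (induction vs arbitrary: ws)
  case (Cons x xs)
  then have "ws = xs \<or> ws \<in> Poly_Mapping.keys (frag_extend (\<lambda>ys. frag_of (x # ys)) (alternating_faces xs))"
    using keys_diff by fastforce
  then show ?case
    using Cons.IH keys_frag_extend by fastforce
qed simp

text \<open>The graded Leibniz rule, with concatenation as the product. It isolates the faces that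
  delete a vertex from one segment of a list.\<close>

lemma alternating_faces_append:
  "alternating_faces (us @ ws) = frag_extend (\<lambda>ys. frag_of (ys @ ws)) (alternating_faces us)
    + frag_cmul ((-1) ^ length us) (frag_extend (\<lambda>ys. frag_of (us @ ys)) (alternating_faces ws))"
proof (induction us)
  case Nil
  show ?case by (simp flip: frag_expansion)
next
  case (Cons x us)
  have *: "frag_extend (\<lambda>ys. frag_of (x # ys)) (frag_extend (\<lambda>ys. frag_of (f ys)) c)
     = frag_extend (\<lambda>ys. frag_of (x # f ys)) c" for c and f :: "'a list \<Rightarrow> 'a list"
    using frag_extend_compose[of "\<lambda>ys. frag_of (x # ys)" f c] by (simp add: o_def)
  have **: "frag_extend (\<lambda>ys. frag_of (ys @ ws)) (frag_extend (\<lambda>ys. frag_of (x # ys)) c)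
     = frag_extend (\<lambda>ys. frag_of (x # ys @ ws)) c" for c
    using frag_extend_compose[of "\<lambda>ys. frag_of (ys @ ws)" "\<lambda>ys. x # ys" c] by (simp add: o_def)
  show ?case
    by (simp add: Cons.IH frag_extend_add frag_extend_diff frag_extend_cmul * **)
qed

section \<open>Additive calculus in the subgroup of orientation relations\<close>

lemma subgroup_orientation_relations:
  "subgroup (orientation_relations K q) (list_chain_group K q)"
  unfolding orientation_relations_def
proof (rule group.generate_is_subgroup)
  have "Poly_Mapping.keys (frag_of (permute_list \<sigma> vs) - frag_cmul (sign \<sigma>) (frag_of vs))
      \<subseteq> vertex_lists K q" if vs: "vs \<in> vertex_lists K q" and \<sigma>: "\<sigma> permutes {..q}" for \<sigma> vs
  proof -
    have "\<sigma> permutes {..<length vs}"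
      using vs \<sigma> by (simp add: vertex_lists_def lessThan_Suc_atMost)
    then have "permute_list \<sigma> vs \<in> vertex_lists K q"
      using vs by (simp add: vertex_lists_def)
    then show ?thesis using vs keys_diff[of "frag_of (permute_list \<sigma> vs)"] by force
  qed
  then show "{frag_of vs |vs. vs \<in> vertex_lists K q \<and> \<not> distinct vs} \<union>
      {frag_of (permute_list \<sigma> vs) - frag_cmul (sign \<sigma>) (frag_of vs) |\<sigma> vs.
        vs \<in> vertex_lists K q \<and> \<sigma> permutes {..q}} \<subseteq> carrier (list_chain_group K q)"
    by auto
qed simp

lemma keys_orientation_relations:
  "c \<in> orientation_relations K q \<Longrightarrow> Poly_Mapping.keys c \<subseteq> vertex_lists K q"
  using subgroup.subset[OF subgroup_orientation_relations] by fastforce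

lemma zero_orientation_relations: "0 \<in> orientation_relations K q"
  using subgroup.one_closed[OF subgroup_orientation_relations] by simp

lemma add_orientation_relations:
  "b \<in> orientation_relations K q \<Longrightarrow> c \<in> orientation_relations K q \<Longrightarrow> b + c \<in> orientation_relations K q"
  using subgroup.m_closed[OF subgroup_orientation_relations] by fastforce

lemma minus_orientation_relations:
  "c \<in> orientation_relations K q \<Longrightarrow> - c \<in> orientation_relations K q"
  using subgroup.m_inv_closed[OF subgroup_orientation_relations] keys_orientation_relations
  by fastforce

lemma diff_orientation_relations:
  "b \<in> orientation_relations K q \<Longrightarrow> c \<in> orientation_relations K q \<Longrightarrow> b - c \<in> orientation_relations K q"
  using add_orientation_relations minus_orientation_relations by fastforce

lemma frag_cmul_orientation_relations:
  "c \<in> orientation_relations K q \<Longrightarrow> frag_cmul n c \<in> orientation_relations K q"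
proof -
  assume c: "c \<in> orientation_relations K q"
  have nat: "frag_cmul (int m) c \<in> orientation_relations K q" for m
    by (induction m)
      (auto simp: frag_cmul_distrib zero_orientation_relations intro!: add_orientation_relations c)
  show ?thesis
    using nat[of "nat \<bar>n\<bar>"] minus_orientation_relations[OF nat[of "nat \<bar>n\<bar>"]]
    by (cases "n \<ge> 0") auto
qed

lemma frag_extend_orientation_relations:
  assumes "\<And>vs. vs \<in> Poly_Mapping.keys c \<Longrightarrow> f vs \<in> orientation_relations K q"
  shows "frag_extend f c \<in> orientation_relations K q"
proof -
  have "frag_extend f c = (\<Sum>vs\<in>Poly_Mapping.keys c. frag_cmul (poly_mapping.lookup c vs) (f vs))"
    by (simp add: frag_extend_def)
  moreover have "(\<Sum>vs\<in>A. frag_cmul (poly_mapping.lookup c vs) (f vs)) \<in> orientation_relations K q"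
    if "finite A" "A \<subseteq> Poly_Mapping.keys c" for A
    using that assms
    by (induction A rule: finite_induct)
      (auto simp: zero_orientation_relations intro!: add_orientation_relations frag_cmul_orientation_relations)
  ultimately show ?thesis by simp
qed

lemma repetition_orientation_relations:
  "vs \<in> vertex_lists K q \<Longrightarrow> \<not> distinct vs \<Longrightarrow> frag_of vs \<in> orientation_relations K q"
  unfolding orientation_relations_def by (rule generate.incl) blast

lemma permute_orientation_relations:
  "vs \<in> vertex_lists K q \<Longrightarrow> \<sigma> permutes {..q} \<Longrightarrow>
    frag_of (permute_list \<sigma> vs) - frag_cmul (sign \<sigma>) (frag_of vs) \<in> orientation_relations K q"
  unfolding orientation_relations_def by (rule generate.incl) blast

text \<open>Induction over generation, with the operations of the free Abelian group replaced by
  those on chains. It transports relations along the boundary, into a larger complex, and back from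
  a union to a stage.\<close>

lemma orientation_relations_induct [consumes 1, case_names zero repetition permute minus add]:
  assumes "c \<in> orientation_relations K q"
    and zero: "P 0"
    and repetition: "\<And>vs. vs \<in> vertex_lists K q \<Longrightarrow> \<not> distinct vs \<Longrightarrow> P (frag_of vs)"
    and permute: "\<And>\<sigma> vs. vs \<in> vertex_lists K q \<Longrightarrow> \<sigma> permutes {..q} \<Longrightarrow>
      P (frag_of (permute_list \<sigma> vs) - frag_cmul (sign \<sigma>) (frag_of vs))"
    and minus: "\<And>c. P c \<Longrightarrow> P (- c)"
    and add: "\<And>b c. P b \<Longrightarrow> P c \<Longrightarrow> P (b + c)"
  shows "P c"
proof -
  define H where "H = {frag_of vs | vs. vs \<in> vertex_lists K q \<and> \<not> distinct vs} \<union>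
     {frag_of (permute_list \<sigma> vs) - frag_cmul (sign \<sigma>) (frag_of vs) | \<sigma> vs.
        vs \<in> vertex_lists K q \<and> \<sigma> permutes {..q}}"
  have H: "P h" if "h \<in> H" for h
    using that repetition permute by (auto simp: H_def)
  have gen: "orientation_relations K q = generate (list_chain_group K q) H"
    by (simp add: orientation_relations_def H_def)
  have "c \<in> generate (list_chain_group K q) H" using assms(1) gen by simp
  then show ?thesis
  proof induction
    \<comment> \<open>The group inverse agrees with negation only on the carrier, so the support of
      \<open>h\<close> has to be controlled before \<open>minus\<close> applies.\<close>
    case (inv h)
    then have "h \<in> orientation_relations K q" unfolding gen by (rule generate.incl)
    then show ?case using minus[OF H[OF inv]] by (simp add: keys_orientation_relations)
  qed (simp_all add: H zero add)
qed

lemma permute_list_transpose_Suc: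
  "permute_list (transpose (length us) (Suc (length us))) (us @ a # b # ws) = us @ b # a # ws"
  by (rule nth_equalityI)
    (auto simp: permute_list_def nth_append transpose_def nth_Cons' simp del: upt_Suc)

text \<open>An adjacent transposition has sign -1, so its relation becomes a sum of the two
  lists.\<close>

lemma swap_orientation_relations:
  assumes "us @ a # b # ws \<in> vertex_lists K q"
  shows "frag_of (us @ b # a # ws) + frag_of (us @ a # b # ws) \<in> orientation_relations K q"
proof -
  have "transpose (length us) (Suc (length us)) permutes {..q}"
    using assms by (intro permutes_swap_id) (auto simp: vertex_lists_def)
  from permute_orientation_relations[OF assms this] show ?thesis
    by (simp add: permute_list_transpose_Suc sign_swap_id)
qed

section \<open>Compatibility of the boundary with orientation relations\<close>

text \<open>The homology definitions accept any family of sets as \<open>K\<close>. This is the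
  condition that keeps boundaries of chains inside the complex; the empty face is left out because
  simplices are nonempty.\<close>

definition face_closed :: "'a set set \<Rightarrow> bool" where
  "face_closed K \<longleftrightarrow> (\<forall>S\<in>K. \<forall>T\<subseteq>S. T \<noteq> {} \<longrightarrow> T \<in> K)"

lemma face_closedD: "face_closed K \<Longrightarrow> S \<in> K \<Longrightarrow> T \<subseteq> S \<Longrightarrow> T \<noteq> {} \<Longrightarrow> T \<in> K"
  unfolding face_closed_def by blast

text \<open>The face \<open>[]\<close> arises only from a list with one vertex, so degree
  \<open>Suc q\<close> guarantees nonempty faces.\<close>

lemma keys_alternating_faces_vertex_lists:
  assumes "face_closed K" "vs \<in> vertex_lists K (Suc q)"
  shows "Poly_Mapping.keys (alternating_faces vs) \<subseteq> vertex_lists K q"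
proof
  fix ws assume "ws \<in> Poly_Mapping.keys (alternating_faces vs)"
  then have ws: "Suc (length ws) = length vs" "set ws \<subseteq> set vs"
    using keys_alternating_faces by blast+
  then have "length ws = Suc q" "set vs \<in> K" using assms by (auto simp: vertex_lists_def)
  then show "ws \<in> vertex_lists K q"
    using face_closedD[OF assms(1) _ ws(2)] by (auto simp: vertex_lists_def simp flip: length_0_conv)
qed

lemma keys_frag_extend_alternating_faces:
  assumes "face_closed K" "Poly_Mapping.keys c \<subseteq> vertex_lists K (Suc q)"
  shows "Poly_Mapping.keys (frag_extend alternating_faces c) \<subseteq> vertex_lists K q"
  using keys_frag_extend[of alternating_faces c] keys_alternating_faces_vertex_lists[OF assms(1)] assms(2)
  by blast

text \<open>By the Leibniz rule, faces deleting a vertex of \<open>us\<close> or \<open>ws\<close>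
  pair up into swap relations one degree lower. The faces deleting \<open>a\<close> or
  \<open>b\<close> occur in both lists with opposite signs and cancel.\<close>

lemma alternating_faces_swap:
  assumes K: "face_closed K" and vs: "us @ a # b # ws \<in> vertex_lists K (Suc q)"
  shows "alternating_faces (us @ b # a # ws) + alternating_faces (us @ a # b # ws)
    \<in> orientation_relations K q"
proof -
  define R where "R = (\<lambda>ts ys. frag_of (ts @ b # a # ys) + (frag_of (ts @ a # b # ys) :: 'a list \<Rightarrow>\<^sub>0 int))"
  have len: "length us + length ws = q" and S: "set (us @ a # b # ws) \<in> K"
    using vs by (auto simp: vertex_lists_def)
  have R: "R ts ys \<in> orientation_relations K q"
    if "Suc (length ts + length ys) = q" "set ts \<subseteq> set us" "set ys \<subseteq> set ws" for ts ys
    unfolding R_def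
  proof (rule swap_orientation_relations)
    have "set (ts @ a # b # ys) \<in> K" using that by (intro face_closedD[OF K S]) auto
    then show "ts @ a # b # ys \<in> vertex_lists K q" using that by (simp add: vertex_lists_def)
  qed
  have eq: "frag_extend (\<lambda>ys. R (f ys) (g ys)) c =
     frag_extend (\<lambda>ys. frag_of (f ys @ b # a # g ys)) c + frag_extend (\<lambda>ys. frag_of (f ys @ a # b # g ys)) c"
    for f g and c :: "'a list \<Rightarrow>\<^sub>0 int"
    by (simp add: R_def frag_extend_def frag_cmul_distrib2 sum.distrib)
  have comp: "frag_extend (\<lambda>ys. frag_of (f ys)) (frag_extend (\<lambda>ys. frag_of (g ys)) c)
     = frag_extend (\<lambda>ys. frag_of (f (g ys))) c" for c :: "'a list \<Rightarrow>\<^sub>0 int" and f g :: "'a list \<Rightarrow> 'a list"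
    using frag_extend_compose[of "\<lambda>ys. frag_of (f ys)" g c] by (simp add: o_def)
  have "alternating_faces (us @ b # a # ws) + alternating_faces (us @ a # b # ws)
    = frag_extend (\<lambda>ts. R ts ws) (alternating_faces us)
      + frag_cmul ((-1) ^ length us) (frag_extend (\<lambda>ys. R us ys) (alternating_faces ws))"
    by (simp add: alternating_faces_append eq frag_extend_diff frag_cmul_distrib2 comp
        frag_extend_add algebra_simps flip: frag_cmul_distrib2)
  moreover have "frag_extend (\<lambda>ts. R ts ws) (alternating_faces us) \<in> orientation_relations K q"
    by (intro frag_extend_orientation_relations R; drule keys_alternating_faces) (use len in auto)
  moreover have "frag_extend (\<lambda>ys. R us ys) (alternating_faces ws) \<in> orientation_relations K q"
    by (intro frag_extend_orientation_relations R; drule keys_alternating_faces) (use len in auto)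
  ultimately show ?thesis
    by (simp add: add_orientation_relations frag_cmul_orientation_relations)
qed

text \<open>The Leibniz argument handles neighbouring vertices only, whereas
  \<open>permutes_induct\<close> produces arbitrary transpositions. These are conjugates of adjacent
  ones, which is why closure under composition is assumed for general \<open>f\<close> and
  \<open>g\<close>.\<close>

lemma permutes_induct_adjacent [consumes 1, case_names id adjacent comp]:
  fixes q :: nat
  assumes p: "p permutes {..q}"
    and P_id: "P id"
    and adjacent: "\<And>i. Suc i \<le> q \<Longrightarrow> P (transpose i (Suc i))"
    and comp: "\<And>f g. f permutes {..q} \<Longrightarrow> g permutes {..q} \<Longrightarrow> P f \<Longrightarrow> P g \<Longrightarrow> P (f \<circ> g)"
  shows "P p"
proof -
  have up: "P (transpose a (a + Suc n))" if "a + Suc n \<le> q" for a n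
    using that
  proof (induction n arbitrary: a)
    case 0
    then show ?case using adjacent by simp
  next
    case (Suc n)
    have 1: "P (transpose (Suc a) (Suc a + Suc n))" using Suc.prems by (intro Suc.IH) simp
    have 2: "P (transpose a (Suc a))" using Suc.prems by (intro adjacent) simp
    have perm: "transpose a (Suc a) permutes {..q}" "transpose (Suc a) (Suc a + Suc n) permutes {..q}"
      using Suc.prems by (intro permutes_swap_id; simp)+
    \<comment> \<open>Conjugation by the adjacent swap moves the endpoint \<open>Suc a\<close> to
      \<open>a\<close> and fixes the other endpoint, so the distance grows by one.\<close>
    have "P (transpose a (Suc a) \<circ> transpose (Suc a) (Suc a + Suc n) \<circ> transpose a (Suc a))"
      by (intro comp permutes_compose 1 2 perm)
    also have "transpose a (Suc a) \<circ> transpose (Suc a) (Suc a + Suc n) \<circ> transpose a (Suc a)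
      = transpose a (a + Suc (Suc n))"
      by (auto simp: transpose_def fun_eq_iff)
    finally show ?case .
  qed
  have transp: "P (transpose a b)" if ab: "a \<le> q" "b \<le> q" "a \<noteq> b" for a b
  proof (cases "a < b")
    case True
    then show ?thesis using up[of a "b - Suc a"] ab by simp
  next
    case False
    then show ?thesis using up[of b "a - Suc b"] ab by (simp add: transpose_commute)
  qed
  show ?thesis using p finite_atMost
  proof (induction rule: permutes_induct)
    case id
    show ?case by (rule P_id)
  next
    case (swap a b p)
    then show ?case by (intro comp transp permutes_swap_id) auto
  qed
qed

lemma frag_cmul_diff_distrib2: "frag_cmul n (a - b) = frag_cmul n a - frag_cmul n b"
  by (rule poly_mapping_eqI) (simp add: lookup_minus algebra_simps)

text \<open>The defect of a composite telescopes: it is the defect of \<open>g\<close> on the list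
  already permuted by \<open>f\<close>, plus a sign times the defect of \<open>f\<close>. The
  induction is therefore over all \<open>vs\<close> at once.\<close>

lemma alternating_faces_permute:
  assumes K: "face_closed K" and "\<sigma> permutes {..Suc q}" "vs \<in> vertex_lists K (Suc q)"
  shows "alternating_faces (permute_list \<sigma> vs) - frag_cmul (sign \<sigma>) (alternating_faces vs)
    \<in> orientation_relations K q"
  using assms(2,3)
proof (induction arbitrary: vs rule: permutes_induct_adjacent)
  case id
  then show ?case by (simp add: zero_orientation_relations)
next
  case (adjacent i)
  have len: "length vs = Suc (Suc q)" using adjacent by (simp add: vertex_lists_def)
  define us where "us = take i vs"
  have "vs = us @ vs ! i # vs ! Suc i # drop (Suc (Suc i)) vs"
    using adjacent len unfolding us_def by (metis Cons_nth_drop_Suc id_take_nth_drop lessI less_SucI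
        less_Suc_eq_le order_less_le_trans Suc_le_eq)
  then obtain a b ws where vs: "vs = us @ a # b # ws" by blast
  have i: "length us = i" using adjacent len by (simp add: us_def)
  show ?case
    using alternating_faces_swap[OF K, of us a b ws q] adjacent.prems
    by (simp add: vs sign_swap_id permute_list_transpose_Suc flip: i)
next
  case (comp f g)
  have len: "{..Suc q} = {..<length vs}"
    using comp.prems by (auto simp: vertex_lists_def)
  have f: "permute_list f vs \<in> vertex_lists K (Suc q)"
    using comp len by (simp add: vertex_lists_def)
  have sign: "sign (f \<circ> g) = sign g * sign f"
    using comp.hyps
    by (metis finite_atMost mult.commute permutation_permutes sign_compose)
  have "alternating_faces (permute_list (f \<circ> g) vs) - frag_cmul (sign (f \<circ> g)) (alternating_faces vs)
    = (alternating_faces (permute_list g (permute_list f vs))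
        - frag_cmul (sign g) (alternating_faces (permute_list f vs)))
      + frag_cmul (sign g) (alternating_faces (permute_list f vs) - frag_cmul (sign f) (alternating_faces vs))"
    using comp.hyps by (simp add: sign permute_list_compose len frag_cmul_diff_distrib2)
  then show ?case
    using comp.IH(1)[OF comp.prems] comp.IH(2)[OF f]
    by (simp only: add_orientation_relations frag_cmul_orientation_relations)
qed

text \<open>Once the repeated vertices are moved to the front, the first two faces cancel.\<close>

lemma alternating_faces_repetition:
  assumes K: "face_closed K" and vs: "vs \<in> vertex_lists K (Suc q)" and "\<not> distinct vs"
  shows "alternating_faces vs \<in> orientation_relations K q"
proof -
  obtain xs c ys zs where "vs = xs @ [c] @ ys @ [c] @ zs"
    using not_distinct_decomp[OF assms(3)] by blast
  define ws where "ws = xs @ ys @ zs"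
  have "mset (c # c # ws) = mset vs" using \<open>vs = _\<close> by (simp add: ws_def)
  then obtain \<sigma> where \<sigma>: "\<sigma> permutes {..<length vs}" "permute_list \<sigma> vs = c # c # ws"
    by (rule mset_eq_permutation)
  have len: "length ws = q" and S: "insert c (set ws) \<in> K"
    using vs \<sigma> \<open>mset _ = mset vs\<close> mset_eq_length[OF \<open>mset _ = mset vs\<close>] mset_eq_setD[OF \<open>mset _ = mset vs\<close>]
    by (auto simp: vertex_lists_def)
  have "\<sigma> permutes {..Suc q}" using \<sigma>(1) vs by (simp add: vertex_lists_def lessThan_Suc_atMost)
  note alternating_faces_permute[OF K this vs]
  moreover have "alternating_faces (permute_list \<sigma> vs) \<in> orientation_relations K q"
  proof -
    have "alternating_faces (c # c # ws) = frag_extend (\<lambda>ys. frag_of (c # c # ys)) (alternating_faces ws)"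
      using frag_extend_compose[of "\<lambda>ys. frag_of (c # ys)" "\<lambda>ys. c # ys" "alternating_faces ws"]
      by (simp add: frag_extend_diff o_def)
    \<comment> \<open>Each surviving face still begins with \<open>c\<close> twice and is thus a
      repetition relation itself.\<close>
    moreover have "frag_of (c # c # ys) \<in> orientation_relations K q"
      if "ys \<in> Poly_Mapping.keys (alternating_faces ws)" for ys
    proof (rule repetition_orientation_relations)
      have "Suc (length ys) = q" "set (c # c # ys) \<subseteq> insert c (set ws)"
        using keys_alternating_faces[OF that] len by auto
      then show "c # c # ys \<in> vertex_lists K q"
        using face_closedD[OF K S] by (auto simp: vertex_lists_def)
    qed simp
    ultimately show ?thesis
      by (simp only: \<sigma>(2) frag_extend_orientation_relations)
  qed
  \<comment> \<open>The permuted list determines the boundary of \<open>vs\<close> only up to the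
    sign of \<open>\<sigma>\<close>; applying the sign a second time removes it, since its square is
    1.\<close>
  ultimately have "frag_cmul (sign \<sigma>) (frag_cmul (sign \<sigma>) (alternating_faces vs)) \<in> orientation_relations K q"
    using frag_cmul_orientation_relations diff_orientation_relations by fastforce
  then show ?thesis by simp
qed

text \<open>This is what makes \<open>boundary\<close> well defined on cosets: it supplies the
  condition on subgroups in \<open>quotient_map_r_coset\<close>.\<close>

lemma alternating_faces_orientation_relations:
  assumes K: "face_closed K" and "c \<in> orientation_relations K (Suc q)"
  shows "frag_extend alternating_faces c \<in> orientation_relations K q"
  using assms(2)
proof (induction rule: orientation_relations_induct)
  case (repetition vs)
  then show ?case using alternating_faces_repetition[OF K] by simp
next
  case (permute \<sigma> vs)
  then show ?case
    using alternating_faces_permute[OF K] by (simp add: frag_extend_diff frag_extend_cmul)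
qed (simp_all add: zero_orientation_relations frag_extend_minus minus_orientation_relations
    frag_extend_add add_orientation_relations)

section \<open>Quotients and direct limits\<close>

lemma quotient_map_hom:
  assumes G: "group G" and G': "group G'" and f: "f \<in> hom G G'"
    and N: "N \<lhd> G" and N': "N' \<lhd> G'" and sub: "f ` N \<subseteq> N'"
  shows "quotient_map G' N' f \<in> hom (G Mod N) (G' Mod N')"
proof (rule homI)
  note val = quotient_map_r_coset[OF G G' f normal_imp_subgroup[OF N] normal_imp_subgroup[OF N'] sub]
  fix A assume "A \<in> carrier (G Mod N)"
  then obtain a where a: "a \<in> carrier G" "A = N #>\<^bsub>G\<^esub> a" by (auto simp: carrier_FactGroup)
  then show "quotient_map G' N' f A \<in> carrier (G' Mod N')"
    using val f by (auto simp: carrier_FactGroup hom_def)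
  fix B assume "B \<in> carrier (G Mod N)"
  then obtain b where b: "b \<in> carrier G" "B = N #>\<^bsub>G\<^esub> b" by (auto simp: carrier_FactGroup)
  have "A <#>\<^bsub>G\<^esub> B = N #>\<^bsub>G\<^esub> (a \<otimes>\<^bsub>G\<^esub> b)"
    using a b by (simp add: normal.rcos_sum[OF N])
  moreover have "a \<otimes>\<^bsub>G\<^esub> b \<in> carrier G"
    using a b G by (simp add: group.is_monoid monoid.m_closed)
  moreover have "f a \<in> carrier G'" "f b \<in> carrier G'" using a b f by (auto simp: hom_def)
  ultimately show "quotient_map G' N' f (A \<otimes>\<^bsub>G Mod N\<^esub> B)
      = quotient_map G' N' f A \<otimes>\<^bsub>G' Mod N'\<^esub> quotient_map G' N' f B"
    using a b f by (simp add: val normal.rcos_sum[OF N'] hom_mult)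
qed

context directed_system
begin

text \<open>Directedness represents any two classes at one index \<open>k\<close>, so
  multiplicativity and injectivity concern the single homomorphism \<open>g k\<close>. For
  injectivity, the quotient of two representatives with equal image lies in the kernel of
  \<open>g k\<close>; it dies at a later index, where the representatives coincide.\<close>

lemma direct_limit_iso:
  assumes H: "group H"
    and g: "\<And>i. i \<in> I \<Longrightarrow> g i \<in> hom (G i) H"
    and compat: "\<And>i j a. i \<in> I \<Longrightarrow> j \<in> I \<Longrightarrow> leq i j \<Longrightarrow> a \<in> carrier (G i) \<Longrightarrow> g j (f i j a) = g i a"
    and surj: "\<And>h. h \<in> carrier H \<Longrightarrow> \<exists>i\<in>I. \<exists>a\<in>carrier (G i). g i a = h"
    and inj: "\<And>i a. i \<in> I \<Longrightarrow> a \<in> carrier (G i) \<Longrightarrow> g i a = \<one>\<^bsub>H\<^esub> \<Longrightarrow>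
      \<exists>j\<in>I. leq i j \<and> f i j a = \<one>\<^bsub>G j\<^esub>"
  shows "direct_limit I leq G f \<cong> H"
proof -
  let ?L = "direct_limit I leq G f"
  let ?S = "SIGMA i:I. carrier (G i)"
  \<comment> \<open>The value on a class is taken at any representative; \<open>compat\<close> makes
    the set of values a singleton.\<close>
  define \<phi> where "\<phi> = (\<lambda>A. the_elem ((\<lambda>(i, a). g i a) ` A))"
  interpret H: group H by fact
  have carrier_L: "carrier ?L = ?S // R" by (simp add: direct_limit_def)
  have classE: "\<exists>i a. i \<in> I \<and> a \<in> carrier (G i) \<and> A = R `` {(i, a)}" if "A \<in> carrier ?L" for A
    using that unfolding carrier_L by (auto elim!: quotientE)
  have class_in: "R `` {(i, a)} \<in> carrier ?L" if "i \<in> I" "a \<in> carrier (G i)" for i a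
    using that unfolding carrier_L by (auto intro: quotientI)
  have \<phi>: "\<phi> (R `` {(i, a)}) = g i a" if "i \<in> I" "a \<in> carrier (G i)" for i a
  proof -
    have eq: "g j b = g i a" if "((i, a), (j, b)) \<in> R" for j b
      using that by (elim relE) (metis compat)
    have "((i, a), (i, a)) \<in> R"
      using that by (intro relI[where k = i] le_refl) auto
    then have "(\<lambda>(i, a). g i a) ` (R `` {(i, a)}) = {g i a}"
      by (fastforce dest: eq)
    then show ?thesis by (simp add: \<phi>_def)
  qed
  have common: "\<exists>k x y. k \<in> I \<and> x \<in> carrier (G k) \<and> y \<in> carrier (G k) \<and> A = R `` {(k, x)} \<and> B = R `` {(k, y)}"
    if A: "A \<in> carrier ?L" and B: "B \<in> carrier ?L" for A B
  proof -
    obtain i a where i: "i \<in> I" "a \<in> carrier (G i)" "A = R `` {(i, a)}" using classE[OF A] by blast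
    obtain j b where j: "j \<in> I" "b \<in> carrier (G j)" "B = R `` {(j, b)}" using classE[OF B] by blast
    obtain k where k: "k \<in> I" "leq i k" "leq j k" using directed i j by blast
    then show ?thesis
      using class_map[OF i(1,2) k(1,2)] class_map[OF j(1,2) k(1,3)] i j
      by (intro exI[of _ k] exI[of _ "f i k a"] exI[of _ "f j k b"]) (simp add: map_closed)
  qed
  have "\<phi> \<in> hom ?L H"
  proof (rule homI)
    show "\<phi> A \<in> carrier H" if A: "A \<in> carrier ?L" for A
      using classE[OF A] \<phi> hom_in_carrier[OF g] by metis
    fix A B assume "A \<in> carrier ?L" "B \<in> carrier ?L"
    then obtain k x y where k: "k \<in> I" "x \<in> carrier (G k)" "y \<in> carrier (G k)"
      and AB: "A = R `` {(k, x)}" "B = R `` {(k, y)}" using common by blast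
    have "A \<otimes>\<^bsub>?L\<^esub> B = R `` {(k, x \<otimes>\<^bsub>G k\<^esub> y)}"
      using class_mult[OF k(1,2) k(1,3) k(1) le_refl le_refl] k by (simp add: AB map_id)
    moreover have "x \<otimes>\<^bsub>G k\<^esub> y \<in> carrier (G k)"
      using k groups by (simp add: group.is_monoid monoid.m_closed)
    ultimately show "\<phi> (A \<otimes>\<^bsub>?L\<^esub> B) = \<phi> A \<otimes>\<^bsub>H\<^esub> \<phi> B"
      using k g by (simp add: \<phi> AB hom_mult)
  qed
  moreover have "bij_betw \<phi> (carrier ?L) (carrier H)"
    unfolding bij_betw_def
  proof
    show "inj_on \<phi> (carrier ?L)"
    proof (rule inj_onI)
      fix A B assume "A \<in> carrier ?L" "B \<in> carrier ?L" and eq: "\<phi> A = \<phi> B"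
      then obtain k x y where k: "k \<in> I" "x \<in> carrier (G k)" "y \<in> carrier (G k)"
        and AB: "A = R `` {(k, x)}" "B = R `` {(k, y)}" using common by blast
      interpret Gk: group "G k" using groups k by blast
      interpret gk: group_hom "G k" H "g k" using g k by unfold_locales
      let ?d = "x \<otimes>\<^bsub>G k\<^esub> inv\<^bsub>G k\<^esub> y"
      have "g k x = g k y" using eq k by (simp add: AB \<phi>)
      then have "g k ?d = \<one>\<^bsub>H\<^esub>" using k by simp
      then obtain j where j: "j \<in> I" "leq k j" "f k j ?d = \<one>\<^bsub>G j\<^esub>"
        using inj[OF k(1), of ?d] k by auto
      interpret Gj: group "G j" using groups j by blast
      interpret fkj: group_hom "G k" "G j" "f k j" using homs k j by unfold_locales
      have "f k j x \<otimes>\<^bsub>G j\<^esub> inv\<^bsub>G j\<^esub> f k j y = \<one>\<^bsub>G j\<^esub>" using j(3) k by simp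
      then have "f k j x = f k j y" using k Gj.inv_solve_right[of "\<one>\<^bsub>G j\<^esub>" "f k j x" "f k j y"] by simp
      then show "A = B" using class_map[OF k(1,2) j(1,2)] class_map[OF k(1,3) j(1,2)] by (simp add: AB)
    qed
    show "\<phi> ` carrier ?L = carrier H"
    proof
      show "\<phi> ` carrier ?L \<subseteq> carrier H" using classE \<phi> hom_in_carrier[OF g] by (metis image_subsetI)
      show "carrier H \<subseteq> \<phi> ` carrier ?L"
      proof
        fix h assume "h \<in> carrier H"
        then obtain i a where "i \<in> I" "a \<in> carrier (G i)" "g i a = h" using surj by blast
        then show "h \<in> \<phi> ` carrier ?L" using class_in \<phi> by (metis imageI)
      qed
    qed
  qed
  ultimately show ?thesis by (auto simp: is_iso_def iso_def)
qed

end

section \<open>Maps induced by inclusions\<close>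

lemma vertex_lists_mono: "K \<subseteq> K' \<Longrightarrow> vertex_lists K q \<subseteq> vertex_lists K' q"
  by (auto simp: vertex_lists_def)

lemma orientation_relations_mono:
  assumes "K \<subseteq> K'"
  shows "orientation_relations K q \<subseteq> orientation_relations K' q"
proof
  fix c assume "c \<in> orientation_relations K q"
  then show "c \<in> orientation_relations K' q"
    using vertex_lists_mono[OF assms, of q]
    by (induction rule: orientation_relations_induct)
      (auto simp: zero_orientation_relations minus_orientation_relations add_orientation_relations
        subset_iff repetition_orientation_relations permute_orientation_relations)
qed

section \<open>Chain groups as quotients and the boundary on cosets\<close>

lemma normal_orientation_relations: "orientation_relations K q \<lhd> list_chain_group K q"
  by (intro comm_group.subgroup_imp_normal abelian_free_Abelian_group subgroup_orientation_relations)

lemma comm_group_chain_group: "comm_group (chain_group K q)"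
  unfolding chain_group_def
  by (intro comm_group.abelian_FactGroup abelian_free_Abelian_group subgroup_orientation_relations)

abbreviation chain_class :: "'a set set \<Rightarrow> nat \<Rightarrow> ('a list \<Rightarrow>\<^sub>0 int) \<Rightarrow> ('a list \<Rightarrow>\<^sub>0 int) set" where
  "chain_class K q c \<equiv> orientation_relations K q #>\<^bsub>list_chain_group K q\<^esub> c"

lemma carrier_chain_group:
  "carrier (chain_group K q) = {chain_class K q c | c. Poly_Mapping.keys c \<subseteq> vertex_lists K q}"
  by (auto simp: chain_group_def carrier_FactGroup)

lemma one_chain_group: "\<one>\<^bsub>chain_group K q\<^esub> = orientation_relations K q"
  by (simp add: chain_group_def)

text \<open>Vanishing of a chain is turned into membership in a generated subgroup, the form to
  which finiteness arguments apply.\<close>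

lemma chain_class_eq_one_iff:
  assumes "Poly_Mapping.keys c \<subseteq> vertex_lists K q"
  shows "chain_class K q c = \<one>\<^bsub>chain_group K q\<^esub> \<longleftrightarrow> c \<in> orientation_relations K q"
proof -
  have "c \<in> carrier (list_chain_group K q)" using assms by simp
  then show ?thesis
    using group.coset_join1[of "list_chain_group K q" "orientation_relations K q" c]
      group.coset_join2[of "list_chain_group K q" c "orientation_relations K q"]
      subgroup_orientation_relations[of K q]
    by (auto simp: one_chain_group keys_orientation_relations)
qed

lemma list_boundary_hom_eq:
  assumes "Poly_Mapping.keys c \<subseteq> vertex_lists K q"
  shows "frag_extend (list_boundary q) c = frag_extend alternating_faces c"
  using assms by (intro frag_extend_eq list_boundary_eq_alternating_faces) (auto simp: vertex_lists_def)

lemma list_boundary_hom: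
  assumes "face_closed K"
  shows "frag_extend (list_boundary (Suc q)) \<in> hom (list_chain_group K (Suc q)) (list_chain_group K q)"
proof (rule homI)
  show "frag_extend (list_boundary (Suc q)) c \<in> carrier (list_chain_group K q)"
    if "c \<in> carrier (list_chain_group K (Suc q))" for c
    using keys_frag_extend_alternating_faces[OF assms] that by (simp add: list_boundary_hom_eq)
qed (simp add: frag_extend_add)

lemma list_boundary_orientation_relations:
  assumes "face_closed K"
  shows "frag_extend (list_boundary (Suc q)) ` orientation_relations K (Suc q) \<subseteq> orientation_relations K q"
  using alternating_faces_orientation_relations[OF assms]
  by (auto simp: list_boundary_hom_eq[OF keys_orientation_relations])

lemma boundary_hom:
  assumes "face_closed K"
  shows "boundary K (Suc q) \<in> hom (chain_group K (Suc q)) (chain_group K q)"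
  unfolding boundary_def chain_group_def diff_Suc_1
  by (intro quotient_map_hom list_boundary_hom list_boundary_orientation_relations assms
      normal_orientation_relations group_free_Abelian_group)

lemma boundary_chain_class:
  assumes K: "face_closed K" and c: "Poly_Mapping.keys c \<subseteq> vertex_lists K (Suc q)"
  shows "boundary K (Suc q) (chain_class K (Suc q) c) = chain_class K q (frag_extend alternating_faces c)"
  using quotient_map_r_coset[OF _ _ list_boundary_hom[OF K] subgroup_orientation_relations
      subgroup_orientation_relations list_boundary_orientation_relations[OF K]] c
  by (simp add: boundary_def list_boundary_hom_eq)

lemma boundary_boundary:
  assumes K: "face_closed K" and "c \<in> carrier (chain_group K (Suc (Suc q)))"
  shows "boundary K (Suc q) (boundary K (Suc (Suc q)) c) = \<one>\<^bsub>chain_group K q\<^esub>"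
proof -
  obtain b where b: "Poly_Mapping.keys b \<subseteq> vertex_lists K (Suc (Suc q))" "c = chain_class K (Suc (Suc q)) b"
    using assms(2) carrier_chain_group by blast
  have "frag_extend alternating_faces (frag_extend alternating_faces b) = 0"
    using b(1)
    by (induction b rule: frag_induction) (auto simp: frag_extend_diff alternating_faces_twice)
  then show ?thesis
    using keys_frag_extend_alternating_faces[OF K b(1)] chain_class_eq_one_iff[of 0 K q]
    by (simp add: b boundary_chain_class[OF K] zero_orientation_relations)
qed

section \<open>Groups of cycles, boundaries and homology classes\<close>

lemma comm_group_subgroup:
  assumes "comm_group G" "subgroup A G"
  shows "comm_group (G\<lparr>carrier := A\<rparr>)"
proof (rule group.group_comm_groupI)
  interpret comm_group G by fact
  show "group (G\<lparr>carrier := A\<rparr>)"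
    by (rule subgroup.subgroup_is_group[OF assms(2) group_axioms])
  show "x \<otimes>\<^bsub>G\<lparr>carrier := A\<rparr>\<^esub> y = y \<otimes>\<^bsub>G\<lparr>carrier := A\<rparr>\<^esub> x"
    if "x \<in> carrier (G\<lparr>carrier := A\<rparr>)" "y \<in> carrier (G\<lparr>carrier := A\<rparr>)" for x y
    using that subgroup.mem_carrier[OF assms(2)] by (simp add: m_comm)
qed

lemma group_chain_group: "group (chain_group K q)"
  by (rule comm_group.axioms(2)[OF comm_group_chain_group])

lemma subgroup_cycles:
  assumes "face_closed K"
  shows "subgroup (cycles K q) (chain_group K q)"
proof (cases q)
  case 0
  then show ?thesis by (simp add: cycles_def group.subgroup_self group_chain_group)
next
  case (Suc p)
  interpret group_hom "chain_group K (Suc p)" "chain_group K p" "boundary K (Suc p)"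
    using boundary_hom[OF assms] by (simp add: group_hom_def group_hom_axioms_def group_chain_group)
  show ?thesis using subgroup_kernel by (simp add: cycles_def Suc)
qed

lemma comm_group_cycle_group: "face_closed K \<Longrightarrow> comm_group (cycle_group K q)"
  unfolding cycle_group_def by (intro comm_group_subgroup comm_group_chain_group subgroup_cycles)

lemma boundaries_subset_cycles:
  assumes "face_closed K"
  shows "boundaries K q \<subseteq> cycles K q"
proof
  fix b assume "b \<in> boundaries K q"
  then obtain c where c: "c \<in> carrier (chain_group K (Suc q))" "b = boundary K (Suc q) c"
    unfolding boundaries_def by blast
  then have "b \<in> carrier (chain_group K q)"
    using hom_in_carrier[OF boundary_hom[OF assms]] by blast
  then show "b \<in> cycles K q"
    using c boundary_boundary[OF assms] by (cases q) (auto simp: cycles_def kernel_def)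
qed

lemma subgroup_boundaries:
  assumes "face_closed K"
  shows "subgroup (boundaries K q) (cycle_group K q)"
proof -
  interpret group_hom "chain_group K (Suc q)" "chain_group K q" "boundary K (Suc q)"
    using boundary_hom[OF assms] by (simp add: group_hom_def group_hom_axioms_def group_chain_group)
  show ?thesis
    unfolding cycle_group_def boundaries_def
    using boundaries_subset_cycles[OF assms] unfolding boundaries_def
    by (intro group.subgroup_incl group_chain_group img_is_subgroup subgroup_cycles assms)
qed

lemma normal_boundaries: "face_closed K \<Longrightarrow> boundaries K q \<lhd> cycle_group K q"
  by (intro comm_group.subgroup_imp_normal comm_group_cycle_group subgroup_boundaries)

lemma group_cycle_group: "face_closed K \<Longrightarrow> group (cycle_group K q)"
  by (rule comm_group.axioms(2)[OF comm_group_cycle_group])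

lemma group_simplicial_homology: "face_closed K \<Longrightarrow> group (simplicial_homology K q)"
  unfolding simplicial_homology_def by (rule normal.factorgroup_is_group[OF normal_boundaries])

section \<open>Induced maps on chains, cycles and homology\<close>

lemma id_list_chain_group_hom:
  "K \<subseteq> K' \<Longrightarrow> (\<lambda>c. c) \<in> hom (list_chain_group K q) (list_chain_group K' q)"
  using vertex_lists_mono[of K K' q] by (auto intro!: homI)

lemma inclusion_chain_class:
  assumes "K \<subseteq> K'" "Poly_Mapping.keys c \<subseteq> vertex_lists K q"
  shows "inclusion_chain_map K' q (chain_class K q c) = chain_class K' q c"
  unfolding inclusion_chain_map_def
  by (rule quotient_map_r_coset)
    (use assms orientation_relations_mono[OF assms(1)] in
      \<open>simp_all add: id_list_chain_group_hom subgroup_orientation_relations\<close>)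

lemma inclusion_chain_map_hom:
  assumes "K \<subseteq> K'"
  shows "inclusion_chain_map K' q \<in> hom (chain_group K q) (chain_group K' q)"
  unfolding inclusion_chain_map_def chain_group_def
  by (rule quotient_map_hom)
    (use orientation_relations_mono[OF assms] in
      \<open>simp_all add: id_list_chain_group_hom assms normal_orientation_relations\<close>)

lemma inclusion_chain_map_id:
  "c \<in> carrier (chain_group K q) \<Longrightarrow> inclusion_chain_map K q c = c"
  by (auto simp: carrier_chain_group inclusion_chain_class)

lemma inclusion_chain_map_comp:
  assumes "K \<subseteq> K'" "K' \<subseteq> K''" "c \<in> carrier (chain_group K q)"
  shows "inclusion_chain_map K'' q (inclusion_chain_map K' q c) = inclusion_chain_map K'' q c"
proof -
  obtain b where b: "Poly_Mapping.keys b \<subseteq> vertex_lists K q" "c = chain_class K q b"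
    using assms(3) by (auto simp: carrier_chain_group)
  moreover have "Poly_Mapping.keys b \<subseteq> vertex_lists K' q"
    using b(1) vertex_lists_mono[OF assms(1)] by blast
  ultimately show ?thesis using assms by (simp add: inclusion_chain_class)
qed

text \<open>Inclusion leaves a representative unchanged and only enlarges its coset, so both sides
  are the class of one and the same chain.\<close>

lemma boundary_inclusion:
  assumes K: "face_closed K" and K': "face_closed K'" and sub: "K \<subseteq> K'"
    and c: "c \<in> carrier (chain_group K (Suc q))"
  shows "boundary K' (Suc q) (inclusion_chain_map K' (Suc q) c)
    = inclusion_chain_map K' q (boundary K (Suc q) c)"
proof -
  obtain b where b: "Poly_Mapping.keys b \<subseteq> vertex_lists K (Suc q)" "c = chain_class K (Suc q) b"
    using c by (auto simp: carrier_chain_group)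
  moreover have "Poly_Mapping.keys b \<subseteq> vertex_lists K' (Suc q)"
    using b(1) vertex_lists_mono[OF sub] by blast
  ultimately show ?thesis
    using keys_frag_extend_alternating_faces[OF K b(1)]
    by (simp add: inclusion_chain_class sub boundary_chain_class K K')
qed

lemma inclusion_one:
  "K \<subseteq> K' \<Longrightarrow> inclusion_chain_map K' q \<one>\<^bsub>chain_group K q\<^esub> = \<one>\<^bsub>chain_group K' q\<^esub>"
  by (rule hom_one[OF inclusion_chain_map_hom group_chain_group group_chain_group])

lemma cycles_subset_carrier: "cycles K q \<subseteq> carrier (chain_group K q)"
  by (auto simp: cycles_def kernel_def)

lemma mem_cycles_Suc:
  "c \<in> cycles K (Suc q) \<longleftrightarrow>
    c \<in> carrier (chain_group K (Suc q)) \<and> boundary K (Suc q) c = \<one>\<^bsub>chain_group K q\<^esub>"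
  by (simp add: cycles_def kernel_def)

lemma cycles_0: "cycles K 0 = carrier (chain_group K 0)"
  by (simp add: cycles_def)

lemma inclusion_cycles:
  assumes "face_closed K" "face_closed K'" "K \<subseteq> K'" "c \<in> cycles K q"
  shows "inclusion_chain_map K' q c \<in> cycles K' q"
proof -
  have c: "c \<in> carrier (chain_group K q)" using assms(4) cycles_subset_carrier by blast
  note incl = hom_in_carrier[OF inclusion_chain_map_hom[OF assms(3)] c]
  show ?thesis
  proof (cases q)
    case 0
    then show ?thesis using incl by (simp add: cycles_0)
  next
    case (Suc p)
    have "boundary K (Suc p) c = \<one>\<^bsub>chain_group K p\<^esub>"
      using assms(4) by (simp add: Suc mem_cycles_Suc)
    then have "boundary K' (Suc p) (inclusion_chain_map K' (Suc p) c) = \<one>\<^bsub>chain_group K' p\<^esub>"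
      using boundary_inclusion[OF assms(1-3), of c p] c inclusion_one[OF assms(3), of p] by (simp only: Suc)
    then show ?thesis using incl by (simp add: Suc mem_cycles_Suc)
  qed
qed

lemma inclusion_boundaries:
  assumes "face_closed K" "face_closed K'" "K \<subseteq> K'"
  shows "inclusion_chain_map K' q ` boundaries K q \<subseteq> boundaries K' q"
proof clarify
  fix b assume "b \<in> boundaries K q"
  then obtain c where c: "c \<in> carrier (chain_group K (Suc q))" "b = boundary K (Suc q) c"
    unfolding boundaries_def by blast
  then have "inclusion_chain_map K' q b = boundary K' (Suc q) (inclusion_chain_map K' (Suc q) c)"
    using boundary_inclusion[OF assms] by simp
  then show "inclusion_chain_map K' q b \<in> boundaries K' q"
    unfolding boundaries_def using hom_in_carrier[OF inclusion_chain_map_hom[OF assms(3)] c(1)] by blast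
qed

lemma inclusion_cycle_group_hom:
  assumes "face_closed K" "face_closed K'" "K \<subseteq> K'"
  shows "inclusion_chain_map K' q \<in> hom (cycle_group K q) (cycle_group K' q)"
proof (rule homI)
  show "inclusion_chain_map K' q c \<in> carrier (cycle_group K' q)" if "c \<in> carrier (cycle_group K q)" for c
    using that inclusion_cycles[OF assms] by (simp add: cycle_group_def)
  show "inclusion_chain_map K' q (b \<otimes>\<^bsub>cycle_group K q\<^esub> c)
      = inclusion_chain_map K' q b \<otimes>\<^bsub>cycle_group K' q\<^esub> inclusion_chain_map K' q c"
    if "b \<in> carrier (cycle_group K q)" "c \<in> carrier (cycle_group K q)" for b c
  proof -
    have "b \<in> carrier (chain_group K q)" "c \<in> carrier (chain_group K q)"
      using that cycles_subset_carrier[of K q] by (auto simp: cycle_group_def)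
    then show ?thesis
      using hom_mult[OF inclusion_chain_map_hom[OF assms(3)]] by (simp add: cycle_group_def)
  qed
qed

abbreviation homology_class ::
    "'a set set \<Rightarrow> nat \<Rightarrow> ('a list \<Rightarrow>\<^sub>0 int) set \<Rightarrow> ('a list \<Rightarrow>\<^sub>0 int) set set" where
  "homology_class K q z \<equiv> boundaries K q #>\<^bsub>cycle_group K q\<^esub> z"

lemma carrier_simplicial_homology:
  "carrier (simplicial_homology K q) = homology_class K q ` cycles K q"
  by (simp add: simplicial_homology_def carrier_FactGroup cycle_group_def)

lemma homology_class_eq_one_iff:
  assumes "face_closed K" "z \<in> cycles K q"
  shows "homology_class K q z = \<one>\<^bsub>simplicial_homology K q\<^esub> \<longleftrightarrow> z \<in> boundaries K q"
proof -
  have z: "z \<in> carrier (cycle_group K q)" using assms(2) by (simp add: cycle_group_def)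
  show ?thesis
    using group.coset_join1[OF group_cycle_group[OF assms(1)] _ z subgroup_boundaries[OF assms(1)]]
      group.coset_join2[OF group_cycle_group[OF assms(1)] z subgroup_boundaries[OF assms(1)]]
    by (auto simp: simplicial_homology_def)
qed

lemma inclusion_homology_class:
  assumes "face_closed K" "face_closed K'" "K \<subseteq> K'" "z \<in> cycles K q"
  shows "inclusion_homology_map K' q (homology_class K q z)
    = homology_class K' q (inclusion_chain_map K' q z)"
  unfolding inclusion_homology_map_def
  by (rule quotient_map_r_coset[OF group_cycle_group group_cycle_group inclusion_cycle_group_hom
      subgroup_boundaries subgroup_boundaries inclusion_boundaries])
    (use assms in \<open>simp_all add: cycle_group_def\<close>)

lemma inclusion_homology_map_hom:
  assumes "face_closed K" "face_closed K'" "K \<subseteq> K'"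
  shows "inclusion_homology_map K' q \<in> hom (simplicial_homology K q) (simplicial_homology K' q)"
  unfolding inclusion_homology_map_def simplicial_homology_def
  by (rule quotient_map_hom[OF group_cycle_group group_cycle_group inclusion_cycle_group_hom
      normal_boundaries normal_boundaries inclusion_boundaries])
    (use assms in simp_all)

lemma inclusion_homology_map_id:
  assumes "face_closed K" "a \<in> carrier (simplicial_homology K q)"
  shows "inclusion_homology_map K q a = a"
proof -
  obtain z where z: "z \<in> cycles K q" "a = homology_class K q z"
    using assms(2) by (auto simp: carrier_simplicial_homology)
  moreover have "inclusion_chain_map K q z = z"
    using z cycles_subset_carrier[of K q] by (intro inclusion_chain_map_id) blast
  ultimately show ?thesis by (simp add: inclusion_homology_class assms(1))
qed

lemma inclusion_homology_map_comp:
  assumes "face_closed K" "face_closed K'" "face_closed K''" "K \<subseteq> K'" "K' \<subseteq> K''"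
    and "a \<in> carrier (simplicial_homology K q)"
  shows "inclusion_homology_map K'' q (inclusion_homology_map K' q a) = inclusion_homology_map K'' q a"
proof -
  obtain z where z: "z \<in> cycles K q" "a = homology_class K q z"
    using assms(6) by (auto simp: carrier_simplicial_homology)
  moreover have "inclusion_chain_map K'' q (inclusion_chain_map K' q z) = inclusion_chain_map K'' q z"
    using z cycles_subset_carrier[of K q] assms by (intro inclusion_chain_map_comp) blast+
  moreover have "K \<subseteq> K''" using assms by blast
  ultimately show ?thesis using assms(1-5) by (simp add: inclusion_homology_class inclusion_cycles)
qed

section \<open>Directed unions of complexes\<close>

text \<open>Indices are kept apart from complexes because distinct indices may carry the same
  complex; \<open>relation_complex X\<close> need not be injective on controlled sets.\<close>

locale directed_complexes =
  fixes I :: "'i set" and leq :: "'i \<Rightarrow> 'i \<Rightarrow> bool" and K :: "'i \<Rightarrow> 'a set set"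
  assumes nonempty: "I \<noteq> {}"
    and le_refl: "i \<in> I \<Longrightarrow> leq i i"
    and le_trans: "i \<in> I \<Longrightarrow> j \<in> I \<Longrightarrow> k \<in> I \<Longrightarrow> leq i j \<Longrightarrow> leq j k \<Longrightarrow> leq i k"
    and directed: "i \<in> I \<Longrightarrow> j \<in> I \<Longrightarrow> \<exists>k\<in>I. leq i k \<and> leq j k"
    and face_closed: "i \<in> I \<Longrightarrow> face_closed (K i)"
    and mono: "i \<in> I \<Longrightarrow> j \<in> I \<Longrightarrow> leq i j \<Longrightarrow> K i \<subseteq> K j"
begin

definition U where "U = (\<Union>i\<in>I. K i)"

lemma subset_U: "i \<in> I \<Longrightarrow> K i \<subseteq> U"
  unfolding U_def by blast

lemma face_closed_U: "face_closed U"
  using face_closed unfolding face_closed_def U_def by blast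

lemma finite_vertex_lists:
  assumes "finite A" "A \<subseteq> vertex_lists U q"
  shows "\<exists>i\<in>I. A \<subseteq> vertex_lists (K i) q"
  using assms
proof (induction A rule: finite_induct)
  case empty
  then show ?case using nonempty by blast
next
  case (insert vs A)
  then obtain i where i: "i \<in> I" "A \<subseteq> vertex_lists (K i) q" by blast
  obtain j where j: "j \<in> I" "vs \<in> vertex_lists (K j) q"
    using insert.prems by (auto simp: vertex_lists_def U_def)
  obtain k where k: "k \<in> I" "leq i k" "leq j k" using directed i j by blast
  then have "vertex_lists (K i) q \<subseteq> vertex_lists (K k) q" "vertex_lists (K j) q \<subseteq> vertex_lists (K k) q"
    using i j by (intro vertex_lists_mono mono; simp)+
  then show ?case using i j k by blast
qed

text \<open>The stage is found from an expression of \<open>c\<close> by generators, not from the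
  support of \<open>c\<close>, in which lists of that expression may have cancelled. Only sums
  require passing to an upper index.\<close>

lemma orientation_relations_U:
  assumes "c \<in> orientation_relations U q"
  shows "\<exists>i\<in>I. c \<in> orientation_relations (K i) q"
proof -
  have lift: "\<exists>i\<in>I. vs \<in> vertex_lists (K i) q" if "vs \<in> vertex_lists U q" for vs
    using finite_vertex_lists[of "{vs}"] that by simp
  from assms show ?thesis
  proof (induction rule: orientation_relations_induct)
    case zero
    then show ?case using nonempty zero_orientation_relations by auto
  next
    case (repetition vs)
    then show ?case using lift repetition_orientation_relations by blast
  next
    case (permute \<sigma> vs)
    then show ?case using lift permute_orientation_relations by blast
  next
    case (minus c)
    then show ?case using minus_orientation_relations by blast
  next
    case (add b c)
    then obtain i j where i: "i \<in> I" "b \<in> orientation_relations (K i) q"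
      and j: "j \<in> I" "c \<in> orientation_relations (K j) q" by blast
    obtain k where k: "k \<in> I" "leq i k" "leq j k" using directed i j by blast
    then have "b \<in> orientation_relations (K k) q" "c \<in> orientation_relations (K k) q"
      using i j orientation_relations_mono[OF mono] by blast+
    then show ?case using k by (auto intro: add_orientation_relations)
  qed
qed

lemma chain_group_U_surj:
  assumes "c \<in> carrier (chain_group U q)"
  shows "\<exists>i\<in>I. \<exists>b\<in>carrier (chain_group (K i) q). inclusion_chain_map U q b = c"
proof -
  obtain d where d: "Poly_Mapping.keys d \<subseteq> vertex_lists U q" "c = chain_class U q d"
    using assms by (auto simp: carrier_chain_group)
  obtain i where i: "i \<in> I" "Poly_Mapping.keys d \<subseteq> vertex_lists (K i) q"
    using finite_vertex_lists d by (meson finite_keys)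
  then have "chain_class (K i) q d \<in> carrier (chain_group (K i) q)"
    by (auto simp: carrier_chain_group)
  moreover have "inclusion_chain_map U q (chain_class (K i) q d) = c"
    using inclusion_chain_class[OF subset_U] i d by blast
  ultimately show ?thesis using i by blast
qed

lemma chain_group_U_inj:
  assumes i: "i \<in> I" and c: "c \<in> carrier (chain_group (K i) q)"
    and one: "inclusion_chain_map U q c = \<one>\<^bsub>chain_group U q\<^esub>"
  shows "\<exists>j\<in>I. leq i j \<and> inclusion_chain_map (K j) q c = \<one>\<^bsub>chain_group (K j) q\<^esub>"
proof -
  obtain d where d: "Poly_Mapping.keys d \<subseteq> vertex_lists (K i) q" "c = chain_class (K i) q d"
    using c by (auto simp: carrier_chain_group)
  then have "chain_class U q d = \<one>\<^bsub>chain_group U q\<^esub>"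
    using one inclusion_chain_class[OF subset_U[OF i]] by simp
  moreover have "Poly_Mapping.keys d \<subseteq> vertex_lists U q"
    using d vertex_lists_mono[OF subset_U[OF i]] by blast
  ultimately have "d \<in> orientation_relations U q"
    using chain_class_eq_one_iff by blast
  then obtain j where j: "j \<in> I" "d \<in> orientation_relations (K j) q"
    using orientation_relations_U by blast
  \<comment> \<open>The stage \<open>j\<close> at which \<open>d\<close> becomes a relation need not
    lie above \<open>i\<close>.\<close>
  obtain k where k: "k \<in> I" "leq i k" "leq j k" using directed i j by blast
  have "d \<in> orientation_relations (K k) q"
    using orientation_relations_mono[OF mono[OF j(1) k(1,3)]] j by blast
  then have "chain_class (K k) q d = \<one>\<^bsub>chain_group (K k) q\<^esub>"
    using chain_class_eq_one_iff keys_orientation_relations by blast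
  then show ?thesis
    using k d inclusion_chain_class[OF mono[OF i k(1,2)]] by auto
qed

text \<open>A chain lifting \<open>z\<close> need not be a cycle at its stage, as its boundary is
  known to vanish only in \<open>U\<close>. By \<open>chain_group_U_inj\<close>, one degree lower,
  that boundary vanishes at a later stage, and the lift pushed there is the desired cycle. Degree 0
  imposes no condition on chains.\<close>

lemma cycles_U:
  assumes "z \<in> cycles U q"
  shows "\<exists>i\<in>I. \<exists>y\<in>cycles (K i) q. inclusion_chain_map U q y = z"
proof (cases q)
  case 0
  then show ?thesis using assms chain_group_U_surj[of z 0] by (simp add: cycles_0)
next
  case (Suc p)
  then have z: "z \<in> carrier (chain_group U (Suc p))" "boundary U (Suc p) z = \<one>\<^bsub>chain_group U p\<^esub>"
    using assms by (simp_all add: mem_cycles_Suc)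
  obtain i b where i: "i \<in> I" and b: "b \<in> carrier (chain_group (K i) (Suc p))"
    "inclusion_chain_map U (Suc p) b = z" using chain_group_U_surj[OF z(1)] by blast
  have "inclusion_chain_map U p (boundary (K i) (Suc p) b) = \<one>\<^bsub>chain_group U p\<^esub>"
    using boundary_inclusion[OF face_closed[OF i] face_closed_U subset_U[OF i] b(1)] b z by simp
  then obtain j where j: "j \<in> I" "leq i j"
    "inclusion_chain_map (K j) p (boundary (K i) (Suc p) b) = \<one>\<^bsub>chain_group (K j) p\<^esub>"
    using chain_group_U_inj[OF i hom_in_carrier[OF boundary_hom[OF face_closed[OF i]] b(1)]] by blast
  let ?y = "inclusion_chain_map (K j) (Suc p) b"
  have "?y \<in> cycles (K j) (Suc p)"
    using hom_in_carrier[OF inclusion_chain_map_hom[OF mono[OF i j(1,2)]] b(1)] j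
      boundary_inclusion[OF face_closed[OF i] face_closed[OF j(1)] mono[OF i j(1,2)] b(1)]
    by (simp add: mem_cycles_Suc)
  moreover have "inclusion_chain_map U (Suc p) ?y = z"
    using inclusion_chain_map_comp[OF mono[OF i j(1,2)] subset_U[OF j(1)] b(1)] b(2) by simp
  ultimately show ?thesis using j Suc by blast
qed

text \<open>Two passages are needed. At \<open>k\<close> both \<open>z\<close> and a lift of the
  bounding chain are available, but \<open>z\<close> and the boundary of the lift agree only after
  mapping to \<open>U\<close>. Their difference vanishes at some \<open>l\<close>, where the image
  of \<open>z\<close> becomes a boundary.\<close>

lemma boundaries_U:
  assumes i: "i \<in> I" and z: "z \<in> carrier (chain_group (K i) q)"
    and bd: "inclusion_chain_map U q z \<in> boundaries U q"
  shows "\<exists>j\<in>I. leq i j \<and> inclusion_chain_map (K j) q z \<in> boundaries (K j) q"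
proof -
  obtain c where c: "c \<in> carrier (chain_group U (Suc q))" "boundary U (Suc q) c = inclusion_chain_map U q z"
    using bd by (auto simp: boundaries_def)
  obtain j b where j: "j \<in> I" and b: "b \<in> carrier (chain_group (K j) (Suc q))"
    "inclusion_chain_map U (Suc q) b = c" using chain_group_U_surj[OF c(1)] by blast
  obtain k where k: "k \<in> I" "leq i k" "leq j k" using directed i j by blast
  note ik = mono[OF i k(1,2)] and jk = mono[OF j k(1,3)]
  interpret Ck: group "chain_group (K k) q" by (rule group_chain_group)
  interpret incl: group_hom "chain_group (K k) q" "chain_group U q" "inclusion_chain_map U q"
    using inclusion_chain_map_hom[OF subset_U[OF k(1)]]
    by (simp add: group_hom_def group_hom_axioms_def group_chain_group)
  define x where "x = inclusion_chain_map (K k) q z"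
  define b' where "b' = inclusion_chain_map (K k) (Suc q) b"
  define y where "y = boundary (K k) (Suc q) b'"
  have x: "x \<in> carrier (chain_group (K k) q)"
    unfolding x_def using hom_in_carrier[OF inclusion_chain_map_hom[OF ik] z] .
  have b': "b' \<in> carrier (chain_group (K k) (Suc q))"
    unfolding b'_def using hom_in_carrier[OF inclusion_chain_map_hom[OF jk] b(1)] .
  have y: "y \<in> carrier (chain_group (K k) q)"
    unfolding y_def using hom_in_carrier[OF boundary_hom[OF face_closed[OF k(1)]] b'] .
  have "inclusion_chain_map U q y = boundary U (Suc q) (inclusion_chain_map U (Suc q) b')"
    unfolding y_def using boundary_inclusion[OF face_closed[OF k(1)] face_closed_U subset_U[OF k(1)] b'] by simp
  also have "inclusion_chain_map U (Suc q) b' = c"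
    unfolding b'_def using inclusion_chain_map_comp[OF jk subset_U[OF k(1)] b(1)] b(2) by simp
  also have "boundary U (Suc q) c = inclusion_chain_map U q x"
    unfolding x_def using inclusion_chain_map_comp[OF ik subset_U[OF k(1)] z] c(2) by simp
  finally have "inclusion_chain_map U q (x \<otimes>\<^bsub>chain_group (K k) q\<^esub> inv\<^bsub>chain_group (K k) q\<^esub> y) = \<one>\<^bsub>chain_group U q\<^esub>"
    using x y by simp
  then obtain l where l: "l \<in> I" "leq k l"
    "inclusion_chain_map (K l) q (x \<otimes>\<^bsub>chain_group (K k) q\<^esub> inv\<^bsub>chain_group (K k) q\<^esub> y) = \<one>\<^bsub>chain_group (K l) q\<^esub>"
    using chain_group_U_inj[OF k(1) Ck.m_closed[OF x Ck.inv_closed[OF y]]] by blast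
  note kl = mono[OF k(1) l(1,2)]
  interpret Cl: group "chain_group (K l) q" by (rule group_chain_group)
  interpret kl: group_hom "chain_group (K k) q" "chain_group (K l) q" "inclusion_chain_map (K l) q"
    using inclusion_chain_map_hom[OF kl]
    by (simp add: group_hom_def group_hom_axioms_def group_chain_group)
  have "inclusion_chain_map (K l) q x = inclusion_chain_map (K l) q y"
    using l(3) x y Cl.inv_solve_right[of "\<one>\<^bsub>chain_group (K l) q\<^esub>" "inclusion_chain_map (K l) q x"
        "inclusion_chain_map (K l) q y"] by simp
  also have "y \<in> boundaries (K k) q" unfolding boundaries_def y_def using b' by blast
  then have "inclusion_chain_map (K l) q y \<in> boundaries (K l) q"
    using inclusion_boundaries[OF face_closed[OF k(1)] face_closed[OF l(1)] kl] by blast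
  finally have "inclusion_chain_map (K l) q x \<in> boundaries (K l) q" .
  moreover have "inclusion_chain_map (K l) q x = inclusion_chain_map (K l) q z"
    unfolding x_def by (rule inclusion_chain_map_comp[OF ik kl z])
  ultimately show ?thesis using l le_trans[OF i k(1) l(1) k(2) l(2)] by auto
qed

lemma directed_system_homology:
  "directed_system I leq (\<lambda>i. simplicial_homology (K i) q) (\<lambda>i j. inclusion_homology_map (K j) q)"
proof (rule directed_system.intro)
  fix i j assume "i \<in> I" "j \<in> I" "leq i j"
  then show "inclusion_homology_map (K j) q \<in> hom (simplicial_homology (K i) q) (simplicial_homology (K j) q)"
    by (intro inclusion_homology_map_hom face_closed mono)
next
  fix i j k a
  assume "i \<in> I" "j \<in> I" "k \<in> I" "leq i j" "leq j k" "a \<in> carrier (simplicial_homology (K i) q)"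
  then show "inclusion_homology_map (K k) q (inclusion_homology_map (K j) q a) = inclusion_homology_map (K k) q a"
    by (intro inclusion_homology_map_comp[of "K i"] face_closed mono)
next
  fix i j k assume "i \<in> I" "j \<in> I" "k \<in> I" "leq i j" "leq j k"
  then show "leq i k" by (rule le_trans)
qed (simp_all add: nonempty le_refl directed face_closed group_simplicial_homology inclusion_homology_map_id)

text \<open>In \<open>direct_limit_iso\<close>, surjectivity comes from \<open>cycles_U\<close> and
  the kernel condition from \<open>boundaries_U\<close>.\<close>

theorem direct_limit_simplicial_homology:
  "direct_limit I leq (\<lambda>i. simplicial_homology (K i) q) (\<lambda>i j. inclusion_homology_map (K j) q)
    \<cong> simplicial_homology U q"
proof (rule directed_system.direct_limit_iso[OF directed_system_homology,
      where g = "\<lambda>i. inclusion_homology_map U q"])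
  show "group (simplicial_homology U q)"
    by (rule group_simplicial_homology[OF face_closed_U])
  show "inclusion_homology_map U q \<in> hom (simplicial_homology (K i) q) (simplicial_homology U q)"
    if "i \<in> I" for i
    using that by (intro inclusion_homology_map_hom face_closed face_closed_U subset_U)
  show "inclusion_homology_map U q (inclusion_homology_map (K j) q a) = inclusion_homology_map U q a"
    if "i \<in> I" "j \<in> I" "leq i j" "a \<in> carrier (simplicial_homology (K i) q)" for i j a
    using that by (intro inclusion_homology_map_comp[of "K i"] face_closed face_closed_U subset_U mono)
next
  fix h assume "h \<in> carrier (simplicial_homology U q)"
  then obtain z where z: "z \<in> cycles U q" "h = homology_class U q z"
    by (auto simp: carrier_simplicial_homology)
  obtain i y where i: "i \<in> I" and y: "y \<in> cycles (K i) q" "inclusion_chain_map U q y = z"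
    using cycles_U[OF z(1)] by blast
  then have "inclusion_homology_map U q (homology_class (K i) q y) = h"
    using inclusion_homology_class[OF face_closed[OF i] face_closed_U subset_U[OF i] y(1)] z by simp
  then show "\<exists>i\<in>I. \<exists>a\<in>carrier (simplicial_homology (K i) q). inclusion_homology_map U q a = h"
    using i y(1) by (auto simp: carrier_simplicial_homology)
next
  fix i a assume i: "i \<in> I" and a: "a \<in> carrier (simplicial_homology (K i) q)"
    and one: "inclusion_homology_map U q a = \<one>\<^bsub>simplicial_homology U q\<^esub>"
  obtain z where z: "z \<in> cycles (K i) q" "a = homology_class (K i) q z"
    using a by (auto simp: carrier_simplicial_homology)
  have "inclusion_chain_map U q z \<in> boundaries U q"
    using one inclusion_homology_class[OF face_closed[OF i] face_closed_U subset_U[OF i] z(1)] z(2)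
      homology_class_eq_one_iff[OF face_closed_U
        inclusion_cycles[OF face_closed[OF i] face_closed_U subset_U[OF i] z(1)]] by simp
  then obtain j where j: "j \<in> I" "leq i j" "inclusion_chain_map (K j) q z \<in> boundaries (K j) q"
    using boundaries_U[OF i] z cycles_subset_carrier by blast
  then have "inclusion_homology_map (K j) q a = \<one>\<^bsub>simplicial_homology (K j) q\<^esub>"
    using inclusion_homology_class[OF face_closed[OF i] face_closed[OF j(1)] mono[OF i j(1,2)] z(1)] z(2)
      homology_class_eq_one_iff[OF face_closed[OF j(1)]
        inclusion_cycles[OF face_closed[OF i] face_closed[OF j(1)] mono[OF i j(1,2)] z(1)]] by simp
  then show "\<exists>j\<in>I. leq i j \<and> inclusion_homology_map (K j) q a = \<one>\<^bsub>simplicial_homology (K j) q\<^esub>"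
    using j by blast
qed

end

section \<open>The complex of the roof\<close>

text \<open>One-vertex faces are simplices whatever \<open>E\<close> is, even without the pair
  \<open>(x, x)\<close>. A face with at least two vertices forces \<open>S\<close> to have at least
  two, so \<open>S\<close> satisfies the condition on pairs and the face inherits it.\<close>

lemma face_closed_relation_complex: "face_closed (relation_complex X E)"
  unfolding face_closed_def
proof (intro ballI allI impI)
  fix S T assume S: "S \<in> relation_complex X E" and T: "T \<subseteq> S" "T \<noteq> {}"
  have fin: "finite S" "S \<subseteq> X" using S by (auto simp: relation_complex_def)
  then have finT: "finite T" using T finite_subset by blast
  show "T \<in> relation_complex X E"
  proof (cases "card T = 1")
    case True
    then show ?thesis using fin T by (auto simp: relation_complex_def card_1_singleton_iff)
  next
    case False
    then have T2: "2 \<le> card T" using finT T(2) card_0_eq[OF finT] by linarith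
    moreover have "card T \<le> card S" using card_mono fin T by blast
    ultimately have "\<forall>x\<in>S. \<forall>y\<in>S. (x, y) \<in> E" using S by (auto simp: relation_complex_def)
    then show ?thesis using T2 finT T fin unfolding relation_complex_def by blast
  qed
qed

lemma relation_complex_mono: "E \<subseteq> E' \<Longrightarrow> relation_complex X E \<subseteq> relation_complex X E'"
  unfolding relation_complex_def by blast

context semi_coarse_space
begin

lemma finite_subset_roof:
  assumes "finite P" "P \<subseteq> roof \<V>"
  shows "P \<in> \<V>"
  using assms
proof (induction P rule: finite_induct)
  case empty
  then show ?case using controlled_mono[OF diagonal_controlled] by blast
next
  case (insert p P)
  then obtain V where V: "V \<in> \<V>" "p \<in> V" by (auto simp: roof_def)
  have "V \<union> P \<in> \<V>" using insert V by (intro controlled_Un) auto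
  then show ?case by (rule controlled_mono) (use V in blast)
qed

lemma relation_complex_roof: "relation_complex X (roof \<V>) = (\<Union>V\<in>\<V>. relation_complex X V)"
proof
  show "(\<Union>V\<in>\<V>. relation_complex X V) \<subseteq> relation_complex X (roof \<V>)"
    by (intro UN_least relation_complex_mono) (auto simp: roof_def)
  show "relation_complex X (roof \<V>) \<subseteq> (\<Union>V\<in>\<V>. relation_complex X V)"
  proof
    fix S assume "S \<in> relation_complex X (roof \<V>)"
    then consider x where "x \<in> X" "S = {x}"
      | "finite S" "2 \<le> card S" "S \<subseteq> X" "\<forall>x\<in>S. \<forall>y\<in>S. (x, y) \<in> roof \<V>"
      unfolding relation_complex_def by blast
    then show "S \<in> (\<Union>V\<in>\<V>. relation_complex X V)"
    proof cases
      case 1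
      \<comment> \<open>Every relation has all singletons of \<open>X\<close> in its complex; the
        diagonal just exhibits one controlled set.\<close>
      then show ?thesis using diagonal_controlled by (auto simp: relation_complex_def)
    next
      case 2
      \<comment> \<open>The square of the vertex set is the least relation having \<open>S\<close>
        as a simplex, and it is finite.\<close>
      then have "S \<times> S \<in> \<V>" by (intro finite_subset_roof) auto
      moreover have "S \<in> relation_complex X (S \<times> S)" using 2 by (auto simp: relation_complex_def)
      ultimately show ?thesis by blast
    qed
  qed
qed

end

theorem theorem4p2p2:
  fixes X :: "'a set" and \<V> :: "('a \<times> 'a) set set"
  assumes "semi_coarse_space X \<V>"
  shows "\<forall>q. semi_coarse_homology X \<V> q \<cong> relation_homology X (roof \<V>) q"
proof
  fix q
  interpret semi_coarse_space X \<V> by fact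
  interpret directed_complexes \<V> "(\<subseteq>)" "relation_complex X"
  proof
    show "\<V> \<noteq> {}" using diagonal_controlled by blast
    show "\<exists>W\<in>\<V>. U \<subseteq> W \<and> V \<subseteq> W" if "U \<in> \<V>" "V \<in> \<V>" for U V
      using controlled_Un[OF that] by blast
  qed (simp_all add: face_closed_relation_complex relation_complex_mono)
  show "semi_coarse_homology X \<V> q \<cong> relation_homology X (roof \<V>) q"
    \<comment> \<open>The union \<open>U\<close> is the complex of the roof by
      \<open>relation_complex_roof\<close>, although the roof need not be one of the
      indices.\<close>
    using direct_limit_simplicial_homology[of q]
    by (simp add: semi_coarse_homology_def relation_homology_def U_def relation_complex_roof)
qed

end
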